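(* There exists an absolute constant $c_1>0$ such that for every $\beta\in(0,1)$ there exists a constant $\alpha=\alpha(\beta)>1$ depending only on $\beta$ with the following property: for every $n\geq 1$, every centered convex body $K$ in $\mathbb{R}^n$ and every integer $N$ with $\alpha n\leq N\leq e^n$, if $x_1,\ldots,x_N$ are independent random points uniformly distributed in $K$, then $$\mathrm{conv}(\{x_1,\ldots,x_N\})\supseteq \frac{c_1\beta\log(N/n)}{n}\,K$$ with probability greater than $1-e^{-N^{1-\beta}n^{\beta}}$.
   Context: A convex body in $\mathbb{R}^n$ is a compact convex subset of $\mathbb{R}^n$ with non-empty interior. A convex body $K$ is centered if its center of mass $\frac{1}{|K|}\int_K x\,dx$ is the origin, where $|\cdot|$ denotes $n$-dimensional volume. "Uniformly distributed in $K$" means distributed according to normalized Lebesgue measure on $K$. "Absolute constant" means a constant that does not depend on $n$, $K$, $\beta$, $N$, or any other parameter. *)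

theory Defs
  imports "HOL-Probability.Probability" "HOL-Library.Function_Algebras"
begin

text \<open>
  The constants of the theorem must be chosen before the dimension, so the dimension cannot be
  carried by a type. Following \<^const>\<open>Euclidean_space\<close>, \<open>\<real>\<^sup>n\<close> is the linear subspace
  \<open>{x. \<forall>i\<ge>n. x i = 0}\<close> of \<^typ>\<open>nat \<Rightarrow> real\<close>. The pointwise vector space structure below
  makes \<^const>\<open>convex\<close>, \<open>convex hull\<close> and \<open>*\<^sub>R\<close> available on this type.
\<close>

instantiation "fun" :: (type, real_vector) real_vector
begin

definition scaleR_fun :: "real \<Rightarrow> ('a \<Rightarrow> 'b) \<Rightarrow> 'a \<Rightarrow> 'b" where
  "c *\<^sub>R f = (\<lambda>x. c *\<^sub>R f x)"

instance
  by standard (simp_all add: scaleR_fun_def plus_fun_def scaleR_add_right scaleR_add_left)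

end

lemma scaleR_fun_apply [simp]: "(c *\<^sub>R f) x = c *\<^sub>R f x"
  by (simp add: scaleR_fun_def)

text \<open>
  Lebesgue measure on \<open>\<real>\<^sup>n\<close>: the image of the \<open>n\<close>-fold product of one-dimensional Lebesgue
  measure under extension by zero.
\<close>

definition lborel_Rn :: "nat \<Rightarrow> (nat \<Rightarrow> real) measure" where
  "lborel_Rn n =
     distr (\<Pi>\<^sub>M i\<in>{..<n}. lborel) borel (\<lambda>x i. if i < n then x i else 0)"

lemma measurable_extend_zero [measurable]:
  "(\<lambda>x i. if i < n then x i else 0) \<in> (\<Pi>\<^sub>M i\<in>{..<n}. lborel) \<rightarrow>\<^sub>M (borel :: (nat \<Rightarrow> real) measure)"
proof (rule measurable_coordinatewise_then_product)
  show "(\<lambda>x. if i < n then x i else 0) \<in> (\<Pi>\<^sub>M i\<in>{..<n}. lborel) \<rightarrow>\<^sub>M (borel :: real measure)" for i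
    by (cases "i < n") auto
qed

definition convex_body :: "nat \<Rightarrow> (nat \<Rightarrow> real) set \<Rightarrow> bool" where
  "convex_body n K \<longleftrightarrow>
     K \<subseteq> topspace (Euclidean_space n) \<and> compact K \<and> convex K \<and>
     Euclidean_space n interior_of K \<noteq> {}"

definition center_of_mass :: "nat \<Rightarrow> (nat \<Rightarrow> real) set \<Rightarrow> nat \<Rightarrow> real" where
  "center_of_mass n K =
     (\<lambda>i. 1 / measure (lborel_Rn n) K * (LINT x:K|lborel_Rn n. x i))"

definition centered :: "nat \<Rightarrow> (nat \<Rightarrow> real) set \<Rightarrow> bool" where
  "centered n K \<longleftrightarrow> center_of_mass n K = 0"

text \<open>
  The joint law of \<open>N\<close> independent points \<open>x 0, \<dots>, x (N - 1)\<close> uniformly distributed in \<open>K\<close>.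
\<close>

definition uniform_points :: "nat \<Rightarrow> nat \<Rightarrow> (nat \<Rightarrow> real) set \<Rightarrow> (nat \<Rightarrow> nat \<Rightarrow> real) measure"
  where
  "uniform_points N n K = (\<Pi>\<^sub>M j\<in>{..<N}. uniform_measure (lborel_Rn n) K)"

lemma (in prob_space) distr_eq_uniform_points:
  assumes "N > 0"
    and "indep_vars (\<lambda>_. borel) X {..<N}"
    and "\<And>j. j < N \<Longrightarrow> distr M borel (X j) = uniform_measure (lborel_Rn n) K"
  shows "distr M (\<Pi>\<^sub>M j\<in>{..<N}. borel) (\<lambda>\<omega>. \<lambda>j\<in>{..<N}. X j \<omega>) = uniform_points N n K"
proof -
  have rv: "random_variable borel (X j)" if "j \<in> {..<N}" for j
    using assms(2) that by (auto simp: indep_vars_def)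
  have "distr M (\<Pi>\<^sub>M j\<in>{..<N}. borel) (\<lambda>\<omega>. \<lambda>j\<in>{..<N}. X j \<omega>)
      = (\<Pi>\<^sub>M j\<in>{..<N}. distr M borel (X j))"
    using indep_vars_iff_distr_eq_PiM'[where I = "{..<N}" and M' = "\<lambda>_. borel" and X = X] assms(1,2) rv by auto
  also have "\<dots> = uniform_points N n K"
    unfolding uniform_points_def using assms(3) by (intro PiM_cong) auto
  finally show ?thesis .
qed

end

theory Submission
  imports Defs "Jordan_Normal_Form.Determinant" "HOL-Real_Asymp.Real_Asymp"
begin

text \<open>
  If \<open>t K\<close> is not contained in the convex hull of the sample, then some half-space
  \<open>{y. \<langle>y, u\<rangle> \<le> s}\<close> with \<open>s < t h\<^sub>K(u)\<close> contains all sample points. The pairs \<open>(u, s)\<close> with this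
  containment, restricted to one orthant for \<open>u\<close>, form a pointed polyhedral cone in \<open>\<real>\<^sup>n\<^sup>+\<^sup>1\<close>. So
  \<open>(u, s)\<close> may be taken on an extreme ray, where it is determined up to sign by \<open>n\<close> tight
  constraints out of \<open>N + n\<close>. A half-space determined in this way by some of the points contains
  the at least \<open>N - n\<close> others with probability at most \<open>(1 - q) ^ (N - n)\<close>, where \<open>q\<close> bounds the
  measure of the cap \<open>{y \<in> K. \<langle>y, u\<rangle> \<ge> t h\<^sub>K(u)}\<close> from below.

  The cap contains the image of \<open>{y \<in> K. \<langle>y, u\<rangle> \<ge> 0}\<close> under the homothety of ratio \<open>1 - t\<close> towards a
  point of \<open>K\<close> extremal in direction \<open>u\<close>, and Gruenbaum's inequality gives this half of \<open>K\<close> measure at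
  least \<open>1 / e\<close>. Hence \<open>q \<ge> (1 - t) ^ n / e\<close>. Gruenbaum's inequality follows from the log-concavity of
  \<open>r \<mapsto> |{y \<in> K. \<langle>y, u\<rangle> \<ge> r}|\<close> (Brunn--Minkowski) by Jensen's inequality.
\<close>

section \<open>Brunn--Minkowski inequality\<close>

text \<open>A direction separating a point of \<open>t K\<close> from the sample depends on all
  sample points and ranges over a continuum, so neither independence nor a union bound applies to it
  directly. A candidate computed from \<open>n\<close> rows cures both: the candidates are finite in
  number, and by Fubini each is a fixed half-space for the points outside its index set. A
  degenerate choice of rows yields the zero vector, which the strict inequality in the event
  rejects.

  Put \<open>m = N / n\<close>. Twice the binomial coefficient is at most
  \<open>exp (n * (2 + ln (m + 1)))\<close>. For \<open>t = \<beta> * ln m / (4 * n)\<close> the cap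
  measure is at least \<open>exp (-1) * m powr (- \<beta> / 2)\<close>, so the failure exponent for
  one candidate is of order \<open>n * m powr (1 - \<beta> / 2)\<close>. Once \<open>m\<close> is
  large in terms of \<beta> alone, this beats both the count and the target
  \<open>n * m powr (1 - \<beta>)\<close>, which equals
  \<open>N powr (1 - \<beta>) * n powr \<beta>\<close>. That threshold determines \<alpha>.\<close>

lemma nn_integral_layer_cake:
  fixes f :: "'a \<Rightarrow> real"
  assumes "sigma_finite_measure M" and [measurable]: "f \<in> borel_measurable M"
  shows "(\<integral>\<^sup>+x. ennreal (f x) \<partial>M) =
    (\<integral>\<^sup>+s. indicator {0..} s * emeasure M {x\<in>space M. s < f x} \<partial>lborel)"
proof -
  interpret sigma_finite_measure M by fact
  interpret pair_sigma_finite M lborel ..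
  have "ennreal (f x) = (\<integral>\<^sup>+s. indicator {0..} s * indicator {s. s < f x} s \<partial>lborel)" for x
  proof -
    have "(\<integral>\<^sup>+s. indicator {0..} s * indicator {s. s < f x} s \<partial>lborel)
        = (\<integral>\<^sup>+s. indicator {0..<f x} s \<partial>lborel)"
      by (intro nn_integral_cong) (auto simp: indicator_def)
    also have "\<dots> = ennreal (f x)"
      by (cases "0 \<le> f x") (auto simp: ennreal_neg)
    finally show ?thesis by simp
  qed
  then have "(\<integral>\<^sup>+x. ennreal (f x) \<partial>M) =
      (\<integral>\<^sup>+x. \<integral>\<^sup>+s. indicator {0..} s * indicator {s. s < f x} s \<partial>lborel \<partial>M)"
    by simp
  also have "\<dots> = (\<integral>\<^sup>+s. \<integral>\<^sup>+x. indicator {0..} s * indicator {s. s < f x} s \<partial>M \<partial>lborel)"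
    by (rule Fubini'[symmetric]) measurable
  also have "\<dots> = (\<integral>\<^sup>+s. indicator {0..} s * emeasure M {x\<in>space M. s < f x} \<partial>lborel)"
  proof (intro nn_integral_cong)
    fix s :: real
    have "(\<integral>\<^sup>+x. indicator {0..} s * indicator {s. s < f x} s \<partial>M) =
        indicator {0..} s * (\<integral>\<^sup>+x. indicator {x\<in>space M. s < f x} x \<partial>M)"
      by (subst nn_integral_cmult[symmetric])
         (auto intro!: nn_integral_cong simp: indicator_def)
    then show "(\<integral>\<^sup>+x. indicator {0..} s * indicator {s. s < f x} s \<partial>M) =
        indicator {0..} s * emeasure M {x\<in>space M. s < f x}"
      by simp
  qed
  finally show ?thesis .
qed

lemma affine_image_borel_real:
  fixes A :: "real set"
  assumes "A \<in> sets borel" "c > 0"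
  shows "(\<lambda>x. c * x + d) ` A \<in> sets borel"
    and "emeasure lborel ((\<lambda>x. c * x + d) ` A) = ennreal c * emeasure lborel A"
proof -
  have eq: "(\<lambda>x. c * x + d) ` A = (\<lambda>y. (y - d) / c) -` A \<inter> space borel"
  proof (intro Set.set_eqI iffI)
    fix y assume "y \<in> (\<lambda>y. (y - d) / c) -` A \<inter> space borel"
    then have "(y - d) / c \<in> A" "y = c * ((y - d) / c) + d" using assms by auto
    then show "y \<in> (\<lambda>x. c * x + d) ` A" by blast
  qed (use assms in auto)
  have "(\<lambda>y. (y - d) / c) \<in> borel_measurable borel" by measurable
  then show m: "(\<lambda>x. c * x + d) ` A \<in> sets borel"
    unfolding eq using assms(1) by (rule measurable_sets)
  have "emeasure lborel ((\<lambda>x. c * x + d) ` A) =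
    emeasure (density (distr lborel borel (\<lambda>x. d + c * x)) (\<lambda>_. ennreal \<bar>c\<bar>)) ((\<lambda>x. c * x + d) ` A)"
    using lborel_real_affine[of c d] assms by simp
  also have "\<dots> = ennreal c * emeasure lborel ((\<lambda>x. d + c * x) -` ((\<lambda>x. c * x + d) ` A))"
    using m assms by (simp add: emeasure_density nn_integral_cmult emeasure_distr)
  also have "(\<lambda>x. d + c * x) -` ((\<lambda>x. c * x + d) ` A) = A"
    using assms by auto
  finally show "emeasure lborel ((\<lambda>x. c * x + d) ` A) = ennreal c * emeasure lborel A" .
qed

text \<open>The sets \<open>(1 - l) * A + l * b\<close> and \<open>l * B + (1 - l) * a\<close> both
  lie in \<open>C\<close>. With \<open>a\<close> near \<open>Sup A\<close> and \<open>b\<close> near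
  \<open>Inf B\<close>, the first lies to the left of the second up to an overlap of length at most
  \<open>e\<close>, so their lengths add up to at most the length of \<open>C\<close> plus
  \<open>e\<close>.\<close>

lemma brunn_minkowski_real:
  fixes A B C :: "real set"
  assumes A: "A \<in> sets borel" "A \<noteq> {}" "bdd_above A"
    and B: "B \<in> sets borel" "B \<noteq> {}" "bdd_below B"
    and C: "C \<in> sets borel" and l: "0 < l" "l < 1"
    and sub: "\<And>x y. x \<in> A \<Longrightarrow> y \<in> B \<Longrightarrow> (1 - l) * x + l * y \<in> C"
  shows "ennreal (1 - l) * emeasure lborel A + ennreal l * emeasure lborel B \<le> emeasure lborel C"
proof (rule ennreal_le_epsilon)
  fix e :: real assume e: "e > 0"
  obtain a where a: "a \<in> A" "Sup A - e < a"
    using less_cSup_iff[OF A(2,3), of "Sup A - e"] e by auto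
  obtain b where b: "b \<in> B" "b < Inf B + e"
    using cInf_less_iff[OF B(2,3), of "Inf B + e"] e by auto
  define A1 where "A1 = (\<lambda>x. (1 - l) * x + l * b) ` A"
  define B1 where "B1 = (\<lambda>y. l * y + (1 - l) * a) ` B"
  define p where "p = (1 - l) * Sup A + l * b"
  define r where "r = (1 - l) * a + l * Inf B"
  have m: "A1 \<in> sets borel" "B1 \<in> sets borel"
    unfolding A1_def B1_def using affine_image_borel_real(1) A B l by auto
  have "A1 \<subseteq> C \<inter> {..p}"
    using sub[OF _ b(1)] cSup_upper[OF _ A(3)] l by (auto simp: A1_def p_def)
  then have "emeasure lborel A1 \<le> emeasure lborel (C \<inter> {..p})"
    using C by (intro emeasure_mono) auto
  then have 1: "ennreal (1 - l) * emeasure lborel A \<le> emeasure lborel (C \<inter> {..p})"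
    unfolding A1_def using affine_image_borel_real(2)[OF A(1), of "1 - l"] l by simp
  have rp: "p - r \<le> e" "r \<le> p"
  proof -
    have "p - r = (1 - l) * (Sup A - a) + l * (b - Inf B)" by (simp add: p_def r_def algebra_simps)
    moreover have "(1 - l) * (Sup A - a) \<le> (1 - l) * e" "l * (b - Inf B) \<le> l * e"
      using a b l by (auto intro!: mult_left_mono)
    ultimately show "p - r \<le> e" by (simp add: algebra_simps)
    have "0 \<le> (1 - l) * (Sup A - a)" "0 \<le> l * (b - Inf B)"
      using cSup_upper[OF a(1) A(3)] cInf_lower[OF b(1) B(3)] l by auto
    then show "r \<le> p" using \<open>p - r = _\<close> by linarith
  qed
  \<comment> \<open>The part of \<open>B1\<close> that could meet \<open>A1\<close> is confined to
    \<open>{r..p}\<close>, so it costs at most \<open>e\<close>.\<close>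
  have "B1 \<subseteq> (C \<inter> {p<..}) \<union> {r..p}"
  proof
    fix z assume "z \<in> B1"
    then obtain y where y: "y \<in> B" "z = (1 - l) * a + l * y" by (auto simp: B1_def)
    have "l * Inf B \<le> l * y" using cInf_lower[OF y(1) B(3)] l by simp
    then show "z \<in> (C \<inter> {p<..}) \<union> {r..p}"
      using sub[OF a(1) y(1)] y by (auto simp: r_def)
  qed
  then have "emeasure lborel B1 \<le> emeasure lborel ((C \<inter> {p<..}) \<union> {r..p})"
    using C by (intro emeasure_mono) auto
  also have "\<dots> \<le> emeasure lborel (C \<inter> {p<..}) + emeasure lborel {r..p}"
    using C by (intro emeasure_subadditive) auto
  also have "emeasure lborel {r..p} \<le> ennreal e" using rp by (simp add: ennreal_leI)
  finally have 2: "ennreal l * emeasure lborel B \<le> emeasure lborel (C \<inter> {p<..}) + ennreal e"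
    unfolding B1_def using affine_image_borel_real(2)[OF B(1), of l] l by (simp add: add_left_mono)
  have "emeasure lborel C = emeasure lborel (C \<inter> {..p}) + emeasure lborel (C \<inter> {p<..})"
  proof -
    have "C = (C \<inter> {..p}) \<union> (C \<inter> {p<..})" by auto
    moreover have "(C \<inter> {..p}) \<inter> (C \<inter> {p<..}) = {}" by auto
    ultimately show ?thesis using C plus_emeasure[of "C \<inter> {..p}" lborel "C \<inter> {p<..}"] by simp
  qed
  then show "ennreal (1 - l) * emeasure lborel A + ennreal l * emeasure lborel B
      \<le> emeasure lborel C + ennreal e"
    using add_mono[OF 1 2] by (simp add: add.assoc)
qed

text \<open>Dividing \<open>f\<close> and \<open>g\<close> by their suprema makes the superlevel
  sets of both nonempty at every level in \<open>[0, 1)\<close>, as the one-dimensional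
  Brunn--Minkowski inequality requires. Integrating over the levels gives an arithmetic mean of the
  normalised integrals, which Young's inequality bounds below by the geometric mean.\<close>

lemma prekopa_leindler_real:
  fixes f g h :: "real \<Rightarrow> real"
  assumes int: "integrable lborel f" "integrable lborel g" "integrable lborel h"
    and nonneg: "\<And>x. 0 \<le> f x" "\<And>x. 0 \<le> g x" "\<And>x. 0 \<le> h x"
    and bdd: "bdd_above (range f)" "bdd_above (range g)"
    and supp: "\<And>x. R < \<bar>x\<bar> \<Longrightarrow> f x = 0" "\<And>x. R < \<bar>x\<bar> \<Longrightarrow> g x = 0"
    and l: "0 < l" "l < 1"
    and le: "\<And>x y. f x powr (1 - l) * g y powr l \<le> h ((1 - l) * x + l * y)"
  shows "(\<integral>x. f x \<partial>lborel) powr (1 - l) * (\<integral>x. g x \<partial>lborel) powr l \<le> (\<integral>x. h x \<partial>lborel)"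
proof (cases "(\<integral>x. f x \<partial>lborel) = 0 \<or> (\<integral>x. g x \<partial>lborel) = 0")
  case True
  then show ?thesis using nonneg(3) by (auto intro!: Bochner_Integration.integral_nonneg)
next
  case False
  have [measurable]: "f \<in> borel_measurable borel" "g \<in> borel_measurable borel" "h \<in> borel_measurable borel"
    using int by (auto dest: borel_measurable_integrable)
  define If where "If = (\<integral>x. f x \<partial>lborel)"
  define Ig where "Ig = (\<integral>x. g x \<partial>lborel)"
  have I: "If > 0" "Ig > 0"
    using False nonneg by (auto simp: If_def Ig_def order_less_le intro!: Bochner_Integration.integral_nonneg)
  define a where "a = Sup (range f)"
  define b where "b = Sup (range g)"
  have fa: "f x \<le> a" for x unfolding a_def by (rule cSup_upper[OF _ bdd(1)]) simp
  have gb: "g x \<le> b" for x unfolding b_def by (rule cSup_upper[OF _ bdd(2)]) simp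
  have a: "a > 0"
  proof (rule ccontr)
    assume "\<not> a > 0"
    then have "f x = 0" for x using fa[of x] nonneg(1)[of x] by linarith
    then show False using I by (simp add: If_def)
  qed
  have b: "b > 0"
  proof (rule ccontr)
    assume "\<not> b > 0"
    then have "g x = 0" for x using gb[of x] nonneg(2)[of x] by linarith
    then show False using I by (simp add: Ig_def)
  qed
  \<comment> \<open>With this normalisation of \<open>h\<close>, points at level \<open>s\<close> of
    \<open>f / a\<close> and of \<open>g / b\<close> combine to a point at the same level
    \<open>s\<close> of \<open>h / c\<close>.\<close>
  define c where "c = a powr (1 - l) * b powr l"
  have c: "c > 0" using a b by (simp add: c_def)
  have level: "ennreal (1 - l) * emeasure lborel {x. s < f x / a} +
      ennreal l * emeasure lborel {x. s < g x / b} \<le> emeasure lborel {x. s < h x / c}"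
    if s: "0 \<le> s" "s < 1" for s
  proof (rule brunn_minkowski_real[OF _ _ _ _ _ _ _ l])
    have "s * a < Sup (range f)" "s * b < Sup (range g)"
      using s a b by (simp_all flip: a_def b_def)
    then obtain x y where "s * a < f x" "s * b < g y"
      using less_cSup_iff[OF _ bdd(1)] less_cSup_iff[OF _ bdd(2)] by fastforce
    then show "{x. s < f x / a} \<noteq> {}" "{x. s < g x / b} \<noteq> {}"
      using a b by (auto simp: field_simps)
    have "{x. s < f x / a} \<subseteq> {-R..R}" "{x. s < g x / b} \<subseteq> {-R..R}"
      using supp s by (auto simp: abs_le_iff[symmetric] not_less[symmetric] simp flip: minus_le_iff)
    then show "bdd_above {x. s < f x / a}" "bdd_below {x. s < g x / b}"
      by (meson bdd_above_Icc bdd_above_mono bdd_below_Icc bdd_below_mono)+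
    fix x y assume "x \<in> {x. s < f x / a}" "y \<in> {x. s < g x / b}"
    then have xy: "s * a < f x" "s * b < g y" using a b by (auto simp: field_simps)
    have "s * c = (s * a) powr (1 - l) * (s * b) powr l"
    proof (cases "s = 0")
      case False
      then have "s = s powr (1 - l) * s powr l" using s by (simp flip: powr_add)
      then show ?thesis using s a b by (simp add: powr_mult c_def)
    qed simp
    also have "\<dots> < f x powr (1 - l) * g y powr l"
      using xy s a b l by (intro mult_strict_mono' powr_less_mono2) auto
    also have "\<dots> \<le> h ((1 - l) * x + l * y)" by (rule le)
    finally show "(1 - l) * x + l * y \<in> {x. s < h x / c}" using c by (simp add: field_simps)
  qed measurable
  have cake: "(\<integral>\<^sup>+x. ennreal (u x) \<partial>lborel) =
      (\<integral>\<^sup>+s. indicator {0..<1} s * emeasure lborel {x. s < u x} \<partial>lborel)"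
    if "u \<in> borel_measurable borel" "\<And>x. u x \<le> 1" for u :: "real \<Rightarrow> real"
  proof -
    have "{x. s < u x} = {}" if "s \<ge> 1" for s
      using \<open>\<And>x. u x \<le> 1\<close> that by (force simp: not_less intro: order_trans)
    then show ?thesis
      using that by (subst nn_integral_layer_cake)
        (auto simp: lborel.sigma_finite_measure_axioms indicator_def intro!: nn_integral_cong)
  qed
  have meas: "(\<lambda>s. emeasure lborel {x. s < u x}) \<in> borel_measurable lborel"
    if [measurable]: "u \<in> borel_measurable borel" for u :: "real \<Rightarrow> real"
    by measurable
  have [measurable]: "(\<lambda>s. emeasure lborel {x. s < f x / a}) \<in> borel_measurable lborel"
    "(\<lambda>s. emeasure lborel {x. s < g x / b}) \<in> borel_measurable lborel"
    by (rule meas; measurable)+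
  have "ennreal (1 - l) * (\<integral>\<^sup>+x. ennreal (f x / a) \<partial>lborel) + ennreal l * (\<integral>\<^sup>+x. ennreal (g x / b) \<partial>lborel)
     = (\<integral>\<^sup>+s. indicator {0..<1} s * (ennreal (1 - l) * emeasure lborel {x. s < f x / a} +
          ennreal l * emeasure lborel {x. s < g x / b}) \<partial>lborel)"
    using fa gb a b
    by (simp add: cake nn_integral_add nn_integral_cmult distrib_left mult.left_commute)
  also have "\<dots> \<le> (\<integral>\<^sup>+s. indicator {0..} s * emeasure lborel {x. s < h x / c} \<partial>lborel)"
    using level by (intro nn_integral_mono) (auto simp: indicator_def)
  also have "\<dots> = (\<integral>\<^sup>+x. ennreal (h x / c) \<partial>lborel)"
    by (subst nn_integral_layer_cake) (auto simp: lborel.sigma_finite_measure_axioms)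
  finally have "ennreal (1 - l) * ennreal (If / a) + ennreal l * ennreal (Ig / b)
      \<le> ennreal ((\<integral>x. h x \<partial>lborel) / c)"
    using int nonneg a b c by (simp add: nn_integral_eq_integral If_def Ig_def)
  then have *: "(1 - l) * (If / a) + l * (Ig / b) \<le> (\<integral>x. h x \<partial>lborel) / c"
    using I a b c l nonneg
    by (simp flip: ennreal_mult ennreal_plus add: ennreal_le_iff Bochner_Integration.integral_nonneg)
  have "If powr (1 - l) * Ig powr l = c * ((If / a) powr (1 - l) * (Ig / b) powr l)"
    using I a b by (simp add: c_def powr_divide)
  also have "\<dots> \<le> c * ((1 - l) * (If / a) + l * (Ig / b))"
    using I a b c l by (intro mult_left_mono Youngs_inequality_0) auto
  also have "\<dots> \<le> (\<integral>x. h x \<partial>lborel)" using * c by (simp add: field_simps)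
  finally show ?thesis by (simp add: If_def Ig_def)
qed

text \<open>The multiplicative form carries no dimension in its exponents, so it survives induction
  on \<open>n\<close>: the induction hypothesis for the slices at heights \<open>y\<close> and
  \<open>z\<close> is the pointwise hypothesis of \<open>prekopa_leindler_real\<close> for the slice
  volumes. The common box makes these volumes bounded and zero outside
  \<open>[-R, R]\<close>.\<close>

lemma brunn_minkowski_PiM:
  fixes A B C :: "(nat \<Rightarrow> real) set"
  defines "P \<equiv> \<lambda>n. \<Pi>\<^sub>M i\<in>{..<n::nat}. (lborel :: real measure)"
  assumes l: "0 < l" "l < 1"
    and meas: "A \<in> sets (P n)" "B \<in> sets (P n)" "C \<in> sets (P n)"
    and box: "A \<subseteq> ({..<n} \<rightarrow>\<^sub>E {-R..R})" "B \<subseteq> ({..<n} \<rightarrow>\<^sub>E {-R..R})" "C \<subseteq> ({..<n} \<rightarrow>\<^sub>E {-R..R})"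
    and sub: "\<And>x y. x \<in> A \<Longrightarrow> y \<in> B \<Longrightarrow> (\<lambda>i\<in>{..<n}. (1 - l) * x i + l * y i) \<in> C"
  shows "measure (P n) A powr (1 - l) * measure (P n) B powr l \<le> measure (P n) C"
  using meas box sub
proof (induction n arbitrary: A B C)
  \<comment> \<open>The empty product is a one-point probability space, so the content is that
    \<open>C\<close> is the whole space as soon as \<open>A\<close> and \<open>B\<close> are
    nonempty.\<close>
  case 0
  show ?case
  proof (cases "A = {} \<or> B = {}")
    case False
    then obtain x y where "x \<in> A" "y \<in> B" by auto
    from 0(7)[OF this] have "C = {\<lambda>_. undefined}" using 0(6) by (auto simp: restrict_def)
    moreover have "measure (P 0) C' \<le> 1" for C'
    proof -
      interpret prob_space "P 0" by standard (simp add: P_def PiM_empty space_PiM)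
      show ?thesis by simp
    qed
    moreover have "measure (P 0) {\<lambda>_. undefined} = 1"
      by (simp add: P_def PiM_empty measure_def)
    ultimately show ?thesis
      by (simp add: mult_le_one powr_le1 l less_imp_le)
  qed auto
next
  case (Suc n)
  interpret product_sigma_finite "\<lambda>_::nat. lborel :: real measure" ..
  interpret Pn: sigma_finite_measure "P n" unfolding P_def by (rule sigma_finite) simp
  define slice where "slice X y = {x \<in> space (P n). x(n := y) \<in> X}" for X :: "(nat \<Rightarrow> real) set" and y :: real
  have upd: "(\<lambda>(y, x). x(n := y)) \<in> lborel \<Otimes>\<^sub>M P n \<rightarrow>\<^sub>M P (Suc n)"
  proof -
    have "(\<lambda>p. (\<lambda>(f, y). f(n := y)) (snd p, fst p)) \<in> lborel \<Otimes>\<^sub>M P n \<rightarrow>\<^sub>M P (Suc n)"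
      unfolding P_def lessThan_Suc
      by (rule measurable_compose[OF _ measurable_add_dim[of n "{..<n}" "\<lambda>_. lborel"]]) measurable
    then show ?thesis by (simp add: case_prod_beta)
  qed
  have slice_pair: "{p \<in> space (lborel \<Otimes>\<^sub>M P n). (snd p)(n := fst p) \<in> X} \<in> sets (lborel \<Otimes>\<^sub>M P n)"
    if "X \<in> sets (P (Suc n))" for X
    using measurable_sets[OF upd that] by (simp add: vimage_def case_prod_beta Int_def conj_commute)
  have slice_eq: "slice X y = Pair y -` {p \<in> space (lborel \<Otimes>\<^sub>M P n). (snd p)(n := fst p) \<in> X}" for X y
    by (auto simp: slice_def space_pair_measure)
  have slice_sets: "slice X y \<in> sets (P n)" if "X \<in> sets (P (Suc n))" for X y
    unfolding slice_eq by (rule sets_Pair1[OF slice_pair[OF that]])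
  have slice_box: "slice X y \<subseteq> ({..<n} \<rightarrow>\<^sub>E {-R..R})" "R < \<bar>y\<bar> \<Longrightarrow> slice X y = {}"
    if "X \<subseteq> ({..<Suc n} \<rightarrow>\<^sub>E {-R..R})" for X y
  proof -
    have *: "x i \<in> {-R..R}" if "x \<in> slice X y" "i < n" for x i
      using that subsetD[OF \<open>X \<subseteq> _\<close>, of "x(n := y)"]
      by (auto simp: slice_def PiE_iff dest!: bspec[of _ _ i])
    then show "slice X y \<subseteq> ({..<n} \<rightarrow>\<^sub>E {-R..R})"
      by (auto simp: slice_def P_def space_PiM PiE_iff extensional_def)
    show "slice X y = {}" if "R < \<bar>y\<bar>"
    proof (rule ccontr)
      assume "slice X y \<noteq> {}"
      then obtain x where "x(n := y) \<in> X" by (auto simp: slice_def)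
      then have "(x(n := y)) n \<in> {-R..R}"
        using \<open>X \<subseteq> _\<close> PiE_mem[of "x(n := y)" "{..<Suc n}" "\<lambda>_. {-R..R}" n] by blast
      then show False using that by auto
    qed
  qed
  define V where "V = measure (P n) ({..<n} \<rightarrow>\<^sub>E {-R..R})"
  have box_fin: "({..<n} \<rightarrow>\<^sub>E {-R..R}) \<in> fmeasurable (P n)" for n
    by (rule fmeasurableI)
       (auto simp: P_def emeasure_PiM ennreal_prod_eq_top less_top[symmetric] power_eq_top_ennreal emeasure_lborel_Icc_eq intro!: sets_PiM_I_finite)
  define m where "m X y = measure (P n) (slice X y)" for X y
  have m_em: "emeasure (P n) (slice X y) = ennreal (m X y)"
    and m_le: "m X y \<le> V" and m_0: "R < \<bar>y\<bar> \<Longrightarrow> m X y = 0"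
    if "X \<in> sets (P (Suc n))" "X \<subseteq> ({..<Suc n} \<rightarrow>\<^sub>E {-R..R})" for X y
  proof -
    have "slice X y \<in> fmeasurable (P n)"
      by (rule fmeasurableI2[OF box_fin slice_box(1)[OF that(2)] slice_sets[OF that(1)]])
    then show "emeasure (P n) (slice X y) = ennreal (m X y)"
      unfolding m_def by (rule emeasure_eq_measure2)
    show "m X y \<le> V" unfolding m_def V_def
      by (rule measure_mono_fmeasurable[OF slice_box(1)[OF that(2)] slice_sets[OF that(1)] box_fin])
    show "R < \<bar>y\<bar> \<Longrightarrow> m X y = 0" using slice_box(2)[OF that(2)] by (simp add: m_def)
  qed
  have m_meas: "m X \<in> borel_measurable lborel" if "X \<in> sets (P (Suc n))" for X
  proof -
    have "(\<lambda>y. emeasure (P n) (slice X y)) \<in> borel_measurable lborel"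
      unfolding slice_eq by (rule Pn.measurable_emeasure_Pair[OF slice_pair[OF that]])
    then show ?thesis unfolding m_def measure_def by measurable
  qed
  have m_int: "integrable lborel (m X)" and m_tot: "measure (P (Suc n)) X = (\<integral>y. m X y \<partial>lborel)"
    if X: "X \<in> sets (P (Suc n))" "X \<subseteq> ({..<Suc n} \<rightarrow>\<^sub>E {-R..R})" for X
  proof -
    note [measurable] = m_meas[OF X(1)]
    have "emeasure (P (Suc n)) X = (\<integral>\<^sup>+x. indicator X x \<partial>P (Suc n))" using X by simp
    also have "\<dots> = (\<integral>\<^sup>+y. \<integral>\<^sup>+x. indicator X (x(n := y)) \<partial>P n \<partial>lborel)"
      using X(1) unfolding P_def lessThan_Suc by (subst product_nn_integral_insert_rev) auto
    also have "\<dots> = (\<integral>\<^sup>+y. emeasure (P n) (slice X y) \<partial>lborel)"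
    proof (rule nn_integral_cong)
      fix y
      have "(\<integral>\<^sup>+x. indicator X (x(n := y)) \<partial>P n) = (\<integral>\<^sup>+x. indicator (slice X y) x \<partial>P n)"
        by (rule nn_integral_cong) (auto simp: slice_def indicator_def)
      then show "(\<integral>\<^sup>+x. indicator X (x(n := y)) \<partial>P n) = emeasure (P n) (slice X y)"
        using slice_sets[OF X(1)] by simp
    qed
    also have "\<dots> = (\<integral>\<^sup>+y. ennreal (m X y) \<partial>lborel)" using m_em[OF X] by simp
    finally have eq: "emeasure (P (Suc n)) X = (\<integral>\<^sup>+y. ennreal (m X y) \<partial>lborel)" .
    show int: "integrable lborel (m X)"
    proof (rule Bochner_Integration.integrable_bound)
      show "integrable lborel (\<lambda>y. V * indicator {-R..R} y)"
        by (auto intro!: integrable_real_indicator simp: emeasure_lborel_Icc_eq)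
      have "\<bar>m X y\<bar> \<le> \<bar>V * indicator {-R..R} y\<bar>" for y
        using m_le[OF X, of y] m_0[OF X, of y] measure_nonneg[of "P n"]
        by (cases "R < \<bar>y\<bar>") (auto simp: m_def V_def indicator_def abs_le_iff not_less)
      then show "AE y in lborel. norm (m X y) \<le> norm (V * indicator {-R..R} y)" by simp
    qed measurable
    then show "measure (P (Suc n)) X = (\<integral>y. m X y \<partial>lborel)"
    proof -
      have nonneg: "0 \<le> m X y" for y by (simp add: m_def)
      then have "emeasure (P (Suc n)) X = ennreal (\<integral>y. m X y \<partial>lborel)"
        using eq nn_integral_eq_integral[OF int] by simp
      then show ?thesis
        using nonneg by (simp add: measure_def Bochner_Integration.integral_nonneg)
    qed
  qed
  show ?case
    unfolding m_tot[OF Suc.prems(1,4)] m_tot[OF Suc.prems(2,5)] m_tot[OF Suc.prems(3,6)]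
  proof (rule prekopa_leindler_real[OF m_int[OF Suc.prems(1,4)] m_int[OF Suc.prems(2,5)] m_int[OF Suc.prems(3,6)], where R = R])
    show "bdd_above (range (m A))" "bdd_above (range (m B))"
      using m_le[OF Suc.prems(1,4)] m_le[OF Suc.prems(2,5)] by (auto intro!: bdd_aboveI[of _ V])
    show "m A y powr (1 - l) * m B z powr l \<le> m C ((1 - l) * y + l * z)" for y z
      unfolding m_def
    proof (rule Suc.IH)
      fix u v assume uv: "u \<in> slice A y" "v \<in> slice B z"
      let ?w = "\<lambda>i\<in>{..<n}. (1 - l) * u i + l * v i"
      have "(\<lambda>i\<in>{..<Suc n}. (1 - l) * (u(n := y)) i + l * (v(n := z)) i) \<in> C"
        using Suc.prems(7)[of "u(n := y)" "v(n := z)"] uv unfolding slice_def by blast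
      also have "(\<lambda>i\<in>{..<Suc n}. (1 - l) * (u(n := y)) i + l * (v(n := z)) i) =
          ?w(n := (1 - l) * y + l * z)" by (auto simp: restrict_def fun_eq_iff)
      finally have "?w(n := (1 - l) * y + l * z) \<in> C" .
      moreover have "?w \<in> space (P n)" unfolding P_def space_PiM by simp
      ultimately show "?w \<in> slice C ((1 - l) * y + l * z)" unfolding slice_def by blast
    qed (use Suc.prems slice_sets slice_box in auto)
  qed (use l m_0 Suc.prems in \<open>auto simp: m_def\<close>)
qed

section \<open>Gruenbaum's inequality for log-concave survival functions\<close>

context prob_space
begin

text \<open>The set \<open>{r. F r \<le> u}\<close> is closed upwards but may or may not contain its
  infimum. Exhausting it by half-lines \<open>{d k..}\<close>, with \<open>d k\<close> decreasing
  inside the set, reduces the bound to continuity from below, whether or not \<open>S\<close> has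
  atoms.\<close>

lemma prob_survival_le:
  fixes S :: "'a \<Rightarrow> real"
  assumes [measurable]: "S \<in> borel_measurable M" and u: "0 \<le> u"
  defines "F \<equiv> \<lambda>r. prob {x\<in>space M. r \<le> S x}"
  shows "prob {x\<in>space M. F (S x) \<le> u} \<le> u"
proof -
  define T where "T = {r. F r \<le> u}"
  have F_anti: "F s \<le> F r" if "r \<le> s" for r s
    unfolding F_def using that by (intro finite_measure_mono) auto
  \<comment> \<open>Below every element of \<open>T\<close> that is not its minimum there is a
    rational in \<open>T\<close>; the minimum, if it exists, is \<open>Inf T\<close>.\<close>
  define D where "D = (T \<inter> \<rat>) \<union> ({Inf T} \<inter> T)"
  have D: "countable D" "D \<subseteq> T"
    by (auto simp: D_def intro!: countable_Un countable_rat countable_subset[OF Int_lower2])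
  have cofinal: "\<exists>d\<in>D. d \<le> r" if r: "r \<in> T" for r
  proof (cases "\<exists>s\<in>T. s < r")
    case True
    then obtain s where s: "s \<in> T" "s < r" by auto
    obtain q where q: "q \<in> \<rat>" "s < q" "q < r" using Rats_dense_in_real[OF s(2)] by auto
    then have "q \<in> T" using s F_anti[of s q] by (auto simp: T_def)
    then show ?thesis using q unfolding D_def by (intro bexI[of _ q]) auto
  next
    case False
    then have "Inf T = r" using r by (intro cInf_eq_minimum) (auto simp: not_less)
    then show ?thesis using r by (auto simp: D_def)
  qed
  show ?thesis
  proof (cases "D = {}")
    case True
    then have "T = {}" using cofinal by auto
    then have "{x\<in>space M. F (S x) \<le> u} = {}" by (auto simp: T_def)
    then have "prob {x\<in>space M. F (S x) \<le> u} = 0" by (simp only: measure_empty)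
    then show ?thesis using u by linarith
  next
    case False
    \<comment> \<open>Running minima of an enumeration of \<open>D\<close> make the half-lines
      increase.\<close>
    define d where "d k = Min (from_nat_into D ` {..k})" for k
    have dT: "d k \<in> T" for k
    proof -
      have "d k \<in> from_nat_into D ` {..k}" unfolding d_def by (intro Min_in) auto
      then show ?thesis using from_nat_into[OF False] D by auto
    qed
    have anti: "d j \<le> d k" if "k \<le> j" for j k
      unfolding d_def using that by (intro Min_antimono) auto
    have "{x\<in>space M. F (S x) \<le> u} = (\<Union>k. {x\<in>space M. d k \<le> S x})"
    proof (intro Set.set_eqI iffI)
      fix x assume x: "x \<in> {x\<in>space M. F (S x) \<le> u}"
      then obtain e where e: "e \<in> D" "e \<le> S x" using cofinal[of "S x"] by (auto simp: T_def)
      then have "d (to_nat_on D e) \<le> e"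
        unfolding d_def using D by (intro Min_le) (auto intro!: image_eqI[of _ _ "to_nat_on D e"])
      then have "d (to_nat_on D e) \<le> S x" using e by linarith
      then show "x \<in> (\<Union>k. {x\<in>space M. d k \<le> S x})" using x by auto
    next
      fix x assume "x \<in> (\<Union>k. {x\<in>space M. d k \<le> S x})"
      then obtain k where "x \<in> space M" "d k \<le> S x" by auto
      then show "x \<in> {x\<in>space M. F (S x) \<le> u}" using dT[of k] F_anti[of "d k" "S x"] by (auto simp: T_def)
    qed
    moreover have "(\<lambda>k. prob {x\<in>space M. d k \<le> S x}) \<longlonglongrightarrow> prob (\<Union>k. {x\<in>space M. d k \<le> S x})"
      by (rule finite_Lim_measure_incseq) (auto simp: incseq_def intro: order_trans[OF anti])
    ultimately show ?thesis
      using dT by (auto intro!: LIMSEQ_le_const2 simp: T_def F_def)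
  qed
qed

text \<open>
  Jensen's inequality for the concave function \<open>ln F\<close>: since \<open>F (S x)\<close> is stochastically
  at least uniform on \<open>[0, 1]\<close>, the expectation of \<open>ln (F (S x))\<close> is at least \<open>-1\<close>.
\<close>

lemma survival_at_mean_ge:
  fixes S :: "'a \<Rightarrow> real"
  defines "F \<equiv> \<lambda>r. prob {x\<in>space M. r \<le> S x}"
  assumes int: "integrable M S" and mean: "expectation S = 0"
    and log_concave: "\<And>r s l. 0 < l \<Longrightarrow> l < 1 \<Longrightarrow>
      F r powr (1 - l) * F s powr l \<le> F ((1 - l) * r + l * s)"
  shows "exp (-1) \<le> F 0"
proof -
  have [measurable]: "S \<in> borel_measurable M" using int by auto
  have F_anti: "F s \<le> F r" if "r \<le> s" for r s
    unfolding F_def using that by (intro finite_measure_mono) auto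
  have F_nonneg: "0 \<le> F r" and F_le1: "F r \<le> 1" for r by (auto simp: F_def)
  have [measurable]: "F \<in> borel_measurable borel"
  proof -
    have "mono (\<lambda>r. - F r)" using F_anti by (auto simp: mono_def)
    then have "(\<lambda>r. - (- F r)) \<in> borel_measurable borel"
      by (intro borel_measurable_uminus borel_measurable_mono)
    then show ?thesis by simp
  qed
  have tail: "prob {x\<in>space M. F (S x) \<le> u} \<le> u" if "0 \<le> u" for u
    unfolding F_def by (rule prob_survival_le[OF _ that]) simp
  show ?thesis
  \<comment> \<open>The supporting line of \<open>- ln F\<close> at 0 requires 0 to be interior to
    the region where \<open>F\<close> is positive. If \<open>F\<close> vanishes on the positive
    reals, then \<open>S \<le> 0\<close> almost surely, mean zero forces \<open>S = 0\<close> almost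
    surely, and \<open>F 0 = 1\<close>.\<close>
  proof (cases "\<exists>r>0. F r > 0")
    case True
    then obtain r where r: "r > 0" "F r > 0" by auto
    define I where "I = {r. F r > 0}"
    have I0: "0 \<in> interior I"
    proof (rule interiorI)
      show "{..<r} \<subseteq> I"
      proof
        fix s assume "s \<in> {..<r}"
        then show "s \<in> I" using F_anti[of s r] r unfolding I_def by simp
      qed
    qed (use r in auto)
    have conv: "convex_on I (\<lambda>r. - ln (F r))"
    proof (rule convex_onI)
      show "convex I"
      proof (rule convexI)
        fix x y and u v :: real assume x: "x \<in> I" and y: "y \<in> I" and "0 \<le> u" "0 \<le> v" "u + v = 1"
        have "u * x + v * y \<le> max x y"
          using convex_bound_le[of x "max x y" y u v] \<open>0 \<le> u\<close> \<open>0 \<le> v\<close> \<open>u + v = 1\<close> by simp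
        moreover have "max x y \<in> I" using x y by (simp add: max_def)
        ultimately show "u *\<^sub>R x + v *\<^sub>R y \<in> I" using F_anti[of "u * x + v * y" "max x y"] by (auto simp: I_def)
      qed
      fix l x y :: real assume l: "0 < l" "l < 1" and xy: "x \<in> I" "y \<in> I"
      then have pos: "F x > 0" "F y > 0" by (auto simp: I_def)
      have "(1 - l) * ln (F x) + l * ln (F y) = ln (F x powr (1 - l) * F y powr l)"
        using pos by (simp add: ln_mult ln_powr)
      also have "\<dots> \<le> ln (F ((1 - l) * x + l * y))"
        using pos log_concave[OF l, of x y] by (intro ln_mono) auto
      finally show "- ln (F ((1 - l) *\<^sub>R x + l *\<^sub>R y)) \<le> (1 - l) * - ln (F x) + l * - ln (F y)"
        by simp
    qed
    \<comment> \<open>The right derivative of the convex function \<open>- ln F\<close> at 0, hence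
      the slope of a supporting line there.\<close>
    define m where "m = (INF t\<in>{0<..} \<inter> I. (- ln (F 0) - (- ln (F t))) / (0 - t))"
    have "AE x in M. F (S x) > 0"
    proof -
      have "prob {x\<in>space M. F (S x) \<le> 0} = 0" using tail[of 0] by (simp add: measure_le_0_iff)
      then have "AE x in M. \<not> F (S x) \<le> 0" by (subst (asm) prob_eq_0) auto
      then show ?thesis by eventually_elim auto
    qed
    then have supp: "AE x in M. - ln (F 0) + m * S x \<le> - ln (F (S x))"
    proof eventually_elim
      case (elim x)
      then show ?case using convex_le_Inf_differential[OF conv I0, of "S x"] by (simp add: m_def I_def)
    qed
    have "(\<integral>\<^sup>+x. ennreal (- ln (F (S x))) \<partial>M) =
        (\<integral>\<^sup>+s. indicator {0..} s * emeasure M {x\<in>space M. s < - ln (F (S x))} \<partial>lborel)"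
      by (rule nn_integral_layer_cake) (auto simp: sigma_finite_measure_axioms)
    \<comment> \<open>The tail of \<open>- ln (F (S x))\<close> is dominated by that of a standard
      exponential variable, whose mean is 1.\<close>
    also have "\<dots> \<le> (\<integral>\<^sup>+s. ennreal (exp (- s)) * indicator {0..} s \<partial>lborel)"
    proof (intro nn_integral_mono)
      fix s :: real
      show "indicator {0..} s * emeasure M {x\<in>space M. s < - ln (F (S x))} \<le> ennreal (exp (- s)) * indicator {0..} s"
      proof (cases "0 \<le> s")
        case True
        have "{x\<in>space M. s < - ln (F (S x))} \<subseteq> {x\<in>space M. F (S x) \<le> exp (- s)}"
        proof clarify
          fix x assume "s < - ln (F (S x))"
          then have "F (S x) \<noteq> 0" using True by auto
          then have "0 < F (S x)" using F_nonneg[of "S x"] by linarith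
          then show "F (S x) \<le> exp (- s)"
            using \<open>s < - ln (F (S x))\<close> by (metis exp_le_cancel_iff exp_ln less_eq_real_def less_minus_iff)
        qed
        then have "prob {x\<in>space M. s < - ln (F (S x))} \<le> prob {x\<in>space M. F (S x) \<le> exp (- s)}"
          by (intro finite_measure_mono) auto
        also have "\<dots> \<le> exp (- s)" by (rule tail) simp
        finally show ?thesis using True by (simp add: emeasure_eq_measure ennreal_leI)
      qed simp
    qed
    also have "\<dots> = ennreal (0 - (- exp (- 0)))"
    proof (rule nn_integral_FTC_atLeast)
      show "((\<lambda>s. - exp (- s)) \<longlongrightarrow> 0) (at_top :: real filter)"
        using tendsto_minus[OF filterlim_compose[OF exp_at_bot filterlim_uminus_at_bot_at_top]] by simp
    qed (auto intro!: derivative_eq_intros)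
    finally have nn: "(\<integral>\<^sup>+x. ennreal (- ln (F (S x))) \<partial>M) \<le> 1" by simp
    have nonneg: "0 \<le> - ln (F (S x))" for x
      using F_le1[of "S x"] F_nonneg[of "S x"] by (cases "F (S x) = 0") auto
    have int_ln: "integrable M (\<lambda>x. - ln (F (S x)))"
    proof (rule integrableI_nonneg)
      show "(\<integral>\<^sup>+x. ennreal (- ln (F (S x))) \<partial>M) < \<infinity>" using nn by (auto intro: le_less_trans)
    qed (use nonneg in auto)
    have "- ln (F 0) = expectation (\<lambda>x. - ln (F 0) + m * S x)"
      using int mean by (simp add: prob_space)
    also have "\<dots> \<le> expectation (\<lambda>x. - ln (F (S x)))"
      using int int_ln supp by (intro integral_mono_AE) auto
    also have "\<dots> \<le> 1"
      using nn nn_integral_eq_integral[OF int_ln] nonneg by (simp add: ennreal_le_1)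
    finally have "- 1 \<le> ln (F 0)" by simp
    moreover have "F 0 > 0" using F_anti[of 0 r] r by simp
    ultimately show ?thesis by (simp add: ln_ge_iff)
  next
    case False
    have "AE x in M. \<forall>k::nat. \<not> inverse (real (Suc k)) \<le> S x"
      unfolding AE_all_countable
    proof
      fix k
      have "\<not> F (inverse (real (Suc k))) > 0" using False by (metis inverse_positive_iff_positive of_nat_0_less_iff zero_less_Suc)
      then have "prob {x\<in>space M. inverse (real (Suc k)) \<le> S x} = 0"
        using F_nonneg[of "inverse (real (Suc k))"] unfolding F_def by linarith
      then show "AE x in M. \<not> inverse (real (Suc k)) \<le> S x" by (subst (asm) prob_eq_0) auto
    qed
    then have "AE x in M. 0 \<le> - S x"
    proof eventually_elim
      case (elim x)
      show ?case
      proof (rule ccontr)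
        assume "\<not> 0 \<le> - S x"
        then have "0 < S x" by simp
        then obtain k where "inverse (real (Suc k)) < S x" using reals_Archimedean by blast
        then show False using elim less_imp_le by blast
      qed
    qed
    moreover have "integrable M (\<lambda>x. - S x)" "expectation (\<lambda>x. - S x) = 0" using int mean by auto
    ultimately have "AE x in M. - S x = 0"
      using integral_nonneg_eq_0_iff_AE[of M "\<lambda>x. - S x"] by blast
    then have "AE x in M. 0 \<le> S x" by eventually_elim simp
    then have "F 0 = 1" unfolding F_def by (subst prob_eq_1) auto
    then show ?thesis by simp
  qed
qed

end

section \<open>Caps of convex bodies\<close>

text \<open>The push-forward rescaled by \<open>a ^ n\<close> agrees with the product measure on
  boxes, where the claim splits into \<open>n\<close> one-dimensional scalings, and boxes determine
  the product measure.\<close>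

lemma emeasure_PiM_lborel_affine:
  fixes a :: real and b :: "nat \<Rightarrow> real" and n :: nat
  defines "P \<equiv> \<Pi>\<^sub>M i\<in>{..<n}. (lborel :: real measure)"
  assumes a: "0 < a" and C: "C \<in> sets P"
  shows "ennreal (a ^ n) * emeasure P {x\<in>space P. (\<lambda>i\<in>{..<n}. a * x i + b i) \<in> C} = emeasure P C"
proof -
  interpret product_sigma_finite "\<lambda>_::nat. lborel :: real measure" ..
  define T where "T x = (\<lambda>i\<in>{..<n}. a * x i + b i)" for x :: "nat \<Rightarrow> real"
  have T: "T \<in> P \<rightarrow>\<^sub>M P"
    unfolding T_def P_def by (rule measurable_restrict) measurable
  have eq: "emeasure (density (distr P P T) (\<lambda>_. ennreal (a ^ n))) C =
      ennreal (a ^ n) * emeasure P {x\<in>space P. T x \<in> C}" if "C \<in> sets P" for C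
  proof -
    have "T -` C \<inter> space P = {x\<in>space P. T x \<in> C}" by auto
    then show ?thesis
      using that T by (simp add: emeasure_density nn_integral_cmult emeasure_distr)
  qed
  have "density (distr P P T) (\<lambda>_. ennreal (a ^ n)) = P"
    unfolding P_def
  proof (rule PiM_eqI)
    fix A :: "nat \<Rightarrow> real set" assume A: "\<And>i. i \<in> {..<n} \<Longrightarrow> A i \<in> sets lborel"
    define B where "B i = (\<lambda>y. a * y + b i) -` A i" for i
    have B: "B i \<in> sets borel" "ennreal a * emeasure lborel (B i) = emeasure lborel (A i)" if "i < n" for i
    proof -
      have m: "(\<lambda>y. a * y + b i) \<in> borel_measurable borel" by measurable
      then show "B i \<in> sets borel" unfolding B_def using measurable_sets[OF m, of "A i"] A that by simp
      then have "emeasure lborel ((\<lambda>y. a * y + b i) ` B i) = ennreal a * emeasure lborel (B i)"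
        by (rule affine_image_borel_real(2)[OF _ a])
      moreover have "(\<lambda>y. a * y + b i) ` B i = A i"
        unfolding B_def
      proof (rule image_vimage_eq[THEN trans])
        have "surj (\<lambda>y. a * y + b i)"
          by (rule surjI[of _ "\<lambda>z. (z - b i) / a"]) (use a in simp)
        then show "A i \<inter> range (\<lambda>y. a * y + b i) = A i" by simp
      qed
      ultimately show "ennreal a * emeasure lborel (B i) = emeasure lborel (A i)" by simp
    qed
    have "Pi\<^sub>E {..<n} A \<in> sets P" using A unfolding P_def by (intro sets_PiM_I_finite) auto
    then have "emeasure (density (distr P P T) (\<lambda>_. ennreal (a ^ n))) (Pi\<^sub>E {..<n} A) =
        ennreal (a ^ n) * emeasure P {x\<in>space P. T x \<in> Pi\<^sub>E {..<n} A}" by (rule eq)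
    also have "{x\<in>space P. T x \<in> Pi\<^sub>E {..<n} A} = Pi\<^sub>E {..<n} B"
    proof (intro Set.set_eqI)
      fix x
      have "T x \<in> Pi\<^sub>E {..<n} A \<longleftrightarrow> (\<forall>i<n. a * x i + b i \<in> A i)"
        unfolding T_def PiE_iff by auto
      moreover have "x \<in> space P \<longleftrightarrow> x \<in> extensional {..<n}"
        unfolding P_def space_PiM PiE_iff by simp
      ultimately show "x \<in> {x\<in>space P. T x \<in> Pi\<^sub>E {..<n} A} \<longleftrightarrow> x \<in> Pi\<^sub>E {..<n} B"
        unfolding B_def PiE_iff by auto
    qed
    also have "emeasure P (Pi\<^sub>E {..<n} B) = (\<Prod>i<n. emeasure lborel (B i))"
      unfolding P_def using B by (subst emeasure_PiM) auto
    also have "ennreal (a ^ n) * \<dots> = (\<Prod>i<n. ennreal a * emeasure lborel (B i))"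
      using a by (simp add: prod.distrib ennreal_power)
    also have "\<dots> = (\<Prod>i<n. emeasure lborel (A i))" using B by simp
    finally show "emeasure (density (distr (\<Pi>\<^sub>M i\<in>{..<n}. lborel) (\<Pi>\<^sub>M i\<in>{..<n}. lborel) T) (\<lambda>_. ennreal (a ^ n)))
        (Pi\<^sub>E {..<n} A) = (\<Prod>i\<in>{..<n}. emeasure lborel (A i))" by (simp add: P_def)
  qed (auto simp: P_def)
  then show ?thesis using eq[OF C] by (simp add: T_def)
qed

definition zero_ext :: "nat \<Rightarrow> (nat \<Rightarrow> real) \<Rightarrow> nat \<Rightarrow> real" where
  "zero_ext n x = (\<lambda>i. if i < n then x i else 0)"

text \<open>The bound is explicit because half-space vectors have length \<open>n + 1\<close>, with
  the offset in coordinate \<open>n\<close>: \<open>dot_upto n\<close> sees only the normal,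
  \<open>dot_upto (Suc n)\<close> the whole vector.\<close>

definition dot_upto :: "nat \<Rightarrow> (nat \<Rightarrow> real) \<Rightarrow> (nat \<Rightarrow> real) \<Rightarrow> real" where
  "dot_upto n x y = (\<Sum>i<n. x i * y i)"

lemma borel_measurable_coordinate [measurable]:
  "(\<lambda>y::nat \<Rightarrow> real. y i) \<in> borel_measurable borel"
  by (rule borel_measurable_continuous_onI) simp

lemma borel_measurable_dot_upto [measurable]:
  "(\<lambda>y. dot_upto n y u) \<in> borel_measurable borel"
  unfolding dot_upto_def by measurable

lemma dot_upto_combination:
  "dot_upto n (\<lambda>i. a * x i + b * y i) u = a * dot_upto n x u + b * dot_upto n y u"
  by (simp add: dot_upto_def sum.distrib sum_distrib_left algebra_simps)

section \<open>Volume and uniform distribution of a convex body\<close>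

locale Rn_body =
  fixes n :: nat and K :: "(nat \<Rightarrow> real) set"
  assumes body: "convex_body n K"
begin

abbreviation "P \<equiv> \<Pi>\<^sub>M i\<in>{..<n}. (lborel :: real measure)"
abbreviation "\<mu> \<equiv> uniform_measure (lborel_Rn n) K"

text \<open>\<open>lborel_Rn n\<close> is the push-forward of \<open>P\<close> under
  \<open>zero_ext n\<close>. Volumes are therefore computed as \<open>P\<close>-measures of
  preimages, where slicing and the affine scaling law are available.\<close>

definition pre :: "(nat \<Rightarrow> real) set \<Rightarrow> (nat \<Rightarrow> real) set" where
  "pre A = {x\<in>space P. zero_ext n x \<in> A}"

lemma compact_K: "compact K" and zero_K: "x \<in> K \<Longrightarrow> n \<le> i \<Longrightarrow> x i = 0"
  using body by (auto simp: convex_body_def topspace_Euclidean_space)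

lemma combination_K:
  assumes "x \<in> K" "y \<in> K" "0 \<le> l" "l \<le> 1"
  shows "(\<lambda>i. (1 - l) * x i + l * y i) \<in> K"
proof -
  have "convex K" using body by (simp add: convex_body_def)
  then have "(1 - l) *\<^sub>R x + l *\<^sub>R y \<in> K" using assms by (intro convexD) auto
  then show ?thesis by (simp add: plus_fun_def scaleR_fun_def)
qed

lemma borel_K [measurable]: "K \<in> sets borel"
  using compact_K by (intro borel_closed compact_imp_closed)

lemma K_bounded: obtains R where "\<forall>x\<in>K. \<forall>i. \<bar>x i\<bar> \<le> R"
proof -
  have "bounded ((\<lambda>x. x i) ` K)" for i
    by (intro compact_imp_bounded compact_continuous_image compact_K
        continuous_on_subset[OF continuous_on_product_coordinates]) auto
  then have "\<exists>b. \<forall>x\<in>K. \<bar>x i\<bar> \<le> b" for i by (auto simp: bounded_iff)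
  then obtain b where b: "\<And>i x. x \<in> K \<Longrightarrow> \<bar>x i\<bar> \<le> b i" by metis
  define R where "R = (\<Sum>i<n. \<bar>b i\<bar>)"
  have "\<bar>x i\<bar> \<le> R" if x: "x \<in> K" for x i
  proof (cases "i < n")
    case True
    have "\<bar>x i\<bar> \<le> \<bar>b i\<bar>" using b[OF x, of i] by linarith
    also have "\<dots> \<le> R" unfolding R_def using True by (intro member_le_sum) auto
    finally show ?thesis .
  next
    case False
    then show ?thesis using zero_K[OF x, of i] by (auto simp: R_def sum_nonneg)
  qed
  then show ?thesis using that by blast
qed

lemma zero_ext_measurable: "zero_ext n \<in> P \<rightarrow>\<^sub>M borel"
  unfolding zero_ext_def[abs_def] by (rule measurable_extend_zero)

lemma pre_eq_vimage: "pre A = zero_ext n -` A \<inter> space P"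
  unfolding pre_def by auto

lemma pre_sets: "A \<in> sets borel \<Longrightarrow> pre A \<in> sets P"
  unfolding pre_eq_vimage by (rule measurable_sets[OF zero_ext_measurable])

lemma sets_lborel_Rn [simp, measurable_cong]: "sets (lborel_Rn n) = sets borel"
  and space_lborel_Rn [simp]: "space (lborel_Rn n) = UNIV"
  by (simp_all add: lborel_Rn_def)

lemma emeasure_lborel_Rn: "A \<in> sets borel \<Longrightarrow> emeasure (lborel_Rn n) A = emeasure P (pre A)"
  unfolding pre_eq_vimage lborel_Rn_def
  using emeasure_distr[OF zero_ext_measurable, of A] by (simp add: zero_ext_def[abs_def])

lemma measure_lborel_Rn: "A \<in> sets borel \<Longrightarrow> measure (lborel_Rn n) A = measure P (pre A)"
  by (simp add: measure_def emeasure_lborel_Rn)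

lemma pre_box:
  assumes "\<forall>x\<in>K. \<forall>i. \<bar>x i\<bar> \<le> R" "A \<subseteq> K"
  shows "pre A \<subseteq> ({..<n} \<rightarrow>\<^sub>E {-R..R})"
proof
  fix x assume "x \<in> pre A"
  then have x: "x \<in> extensional {..<n}" "zero_ext n x \<in> K"
    using assms(2) by (auto simp: pre_def space_PiM PiE_iff)
  have "x i \<in> {-R..R}" if "i < n" for i
  proof -
    have "\<bar>zero_ext n x i\<bar> \<le> R" using assms(1) x(2) by blast
    then show ?thesis using that by (auto simp: zero_ext_def)
  qed
  then show "x \<in> ({..<n} \<rightarrow>\<^sub>E {-R..R})" using x by (auto simp: PiE_iff)
qed

lemma volume_finite: "emeasure (lborel_Rn n) K < \<infinity>"
proof -
  interpret product_sigma_finite "\<lambda>_::nat. lborel :: real measure" ..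
  obtain R where R: "\<forall>x\<in>K. \<forall>i. \<bar>x i\<bar> \<le> R" using K_bounded by blast
  have "emeasure (lborel_Rn n) K \<le> emeasure P ({..<n} \<rightarrow>\<^sub>E {-R..R})"
    unfolding emeasure_lborel_Rn[OF borel_K] using pre_box[OF R subset_refl]
    by (intro emeasure_mono sets_PiM_I_finite) auto
  also have "\<dots> < \<infinity>"
    by (auto simp: emeasure_PiM ennreal_prod_eq_top less_top[symmetric] power_eq_top_ennreal emeasure_lborel_Icc_eq)
  finally show ?thesis .
qed

text \<open>An interior point \<open>p\<close> has a neighbourhood that is a product of open sets
  and whose part in the subspace lies in \<open>K\<close>. The first \<open>n\<close> factors form a
  box of positive volume inside \<open>pre K\<close>.\<close>

lemma volume_pos: "0 < emeasure (lborel_Rn n) K"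
proof -
  interpret product_sigma_finite "\<lambda>_::nat. lborel :: real measure" ..
  obtain p where p: "p \<in> Euclidean_space n interior_of K"
    using body by (auto simp: convex_body_def)
  then obtain U where U: "openin (Euclidean_space n) U" "p \<in> U" "U \<subseteq> K"
    by (auto simp: interior_of_def)
  then obtain V where V: "openin (powertop_real UNIV) V" "U = V \<inter> {f. \<forall>i\<ge>n. f i = 0}"
    by (auto simp: Euclidean_space_def openin_subtopology)
  have pV: "p \<in> V" "\<forall>i\<ge>n. p i = 0" using U V by auto
  obtain X where X: "p \<in> (\<Pi>\<^sub>E i\<in>UNIV. X i)" "\<And>i. open (X i)" "(\<Pi>\<^sub>E i\<in>UNIV. X i) \<subseteq> V"
    using product_topology_open_contains_basis[OF V(1) pV(1)] by auto
  have "Pi\<^sub>E {..<n} X \<subseteq> pre K"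
  proof
    fix x assume x: "x \<in> Pi\<^sub>E {..<n} X"
    \<comment> \<open>From coordinate \<open>n\<close> on both the extension and \<open>p\<close>
      are zero, so these factors contain it.\<close>
    have "zero_ext n x \<in> (\<Pi>\<^sub>E i\<in>UNIV. X i)"
      using x X(1) pV(2) by (auto simp: zero_ext_def PiE_iff not_less) (metis)
    then have "zero_ext n x \<in> K" using X(3) V(2) U(3) by (auto simp: zero_ext_def)
    then show "x \<in> pre K" using x by (auto simp: pre_def space_PiM PiE_iff)
  qed
  then have "emeasure P (Pi\<^sub>E {..<n} X) \<le> emeasure (lborel_Rn n) K"
    unfolding emeasure_lborel_Rn[OF borel_K] by (intro emeasure_mono pre_sets borel_K)
  moreover have "emeasure P (Pi\<^sub>E {..<n} X) = (\<Prod>i<n. emeasure lborel (X i))"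
    using X(2) by (subst emeasure_PiM) auto
  moreover have "emeasure lborel (X i) \<noteq> 0" for i
  proof -
    have "p i \<in> X i" using X(1) by (auto simp: PiE_iff)
    then obtain e where e: "e > 0" "cball (p i) e \<subseteq> X i"
      using X(2) open_contains_cball by blast
    then have "emeasure lborel (cball (p i) e) \<le> emeasure lborel (X i)"
      using X(2) by (intro emeasure_mono) auto
    moreover have "emeasure lborel (cball (p i) e) > 0"
      using e by (simp add: cball_eq_atLeastAtMost)
    ultimately show ?thesis by auto
  qed
  then have "0 < (\<Prod>i<n. emeasure lborel (X i))" by (simp add: zero_less_iff_neq_zero)
  ultimately show ?thesis by (metis less_le_trans)
qed

lemma volume_pos_real: "0 < measure (lborel_Rn n) K"
  using volume_pos volume_finite by (simp add: measure_def enn2real_positive_iff)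

lemma sets_mu [simp, measurable_cong]: "sets \<mu> = sets borel" and space_mu [simp]: "space \<mu> = UNIV"
  by simp_all

sublocale mu: prob_space \<mu>
  using volume_pos volume_finite by (intro prob_space_uniform_measure) auto

lemma measure_mu: "A \<in> sets borel \<Longrightarrow> measure \<mu> A = measure P (pre (K \<inter> A)) / measure (lborel_Rn n) K"
  using volume_pos volume_finite
  by (subst measure_uniform_measure) (auto simp: measure_lborel_Rn)

lemma AE_mu_K: "AE y in \<mu>. y \<in> K"
  by (rule AE_uniform_measureI) auto

lemma integrable_mu_coordinate: "integrable \<mu> (\<lambda>y. y i)"
proof -
  obtain R where R: "\<forall>x\<in>K. \<forall>i. \<bar>x i\<bar> \<le> R" using K_bounded by blast
  show ?thesis
  proof (rule mu.integrable_const_bound)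
    show "AE y in \<mu>. norm (y i) \<le> R" using AE_mu_K R by (auto elim!: eventually_mono)
  qed measurable
qed

lemma integral_mu_coordinate:
  assumes "centered n K"
  shows "(\<integral>y. y i \<partial>\<mu>) = 0"
proof -
  let ?V = "measure (lborel_Rn n) K"
  have V: "emeasure (lborel_Rn n) K = ennreal ?V"
    using volume_finite by (simp add: emeasure_eq_ennreal_measure less_top)
  have "\<mu> = density (lborel_Rn n) (\<lambda>x. ennreal (indicator K x / ?V))"
    unfolding uniform_measure_def V
    using volume_pos_real by (intro density_cong AE_I2) (auto simp: divide_ennreal[symmetric] ennreal_indicator[symmetric])
  then have "(\<integral>y. y i \<partial>\<mu>) = (\<integral>y. (indicator K y / ?V) *\<^sub>R y i \<partial>lborel_Rn n)"
    using volume_pos_real by (simp only:) (subst integral_density; simp)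
  also have "\<dots> = center_of_mass n K i"
    by (simp add: center_of_mass_def set_lebesgue_integral_def)
  finally show ?thesis using assms by (simp add: centered_def)
qed

text \<open>The inner product with \<open>u\<close> has mean zero because the centroid is the
  origin. Its survival function is log-concave by Brunn--Minkowski, since convex combinations of
  points in the caps at heights \<open>r\<close> and \<open>s\<close> lie in the cap at height
  \<open>(1 - l) * r + l * s\<close>.\<close>

lemma halfspace_through_centroid:
  assumes "centered n K"
  shows "exp (-1) \<le> measure \<mu> {y. 0 \<le> dot_upto n y u}"
proof -
  let ?F = "\<lambda>r. measure \<mu> {y\<in>space \<mu>. r \<le> dot_upto n y u}"
  let ?V = "measure (lborel_Rn n) K"
  define cap where "cap r = K \<inter> {y\<in>space \<mu>. r \<le> dot_upto n y u}" for r
  have cap: "cap r \<in> sets borel" for r unfolding cap_def by measurable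
  have F: "?F r = measure P (pre (cap r)) / ?V" for r
    unfolding cap_def by (rule measure_mu) measurable
  have "exp (-1) \<le> ?F 0"
  proof (rule mu.survival_at_mean_ge)
    show "integrable \<mu> (\<lambda>y. dot_upto n y u)"
      unfolding dot_upto_def using integrable_mu_coordinate by auto
    show "mu.expectation (\<lambda>y. dot_upto n y u) = 0"
      unfolding dot_upto_def using integrable_mu_coordinate integral_mu_coordinate[OF assms] by simp
    fix r s l :: real assume l: "0 < l" "l < 1"
    obtain R where R: "\<forall>x\<in>K. \<forall>i. \<bar>x i\<bar> \<le> R" using K_bounded by blast
    have box: "pre (cap a) \<subseteq> ({..<n} \<rightarrow>\<^sub>E {-R..R})" for a
      by (rule pre_box[OF R]) (auto simp: cap_def)
    have "measure P (pre (cap r)) powr (1 - l) * measure P (pre (cap s)) powr l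
        \<le> measure P (pre (cap ((1 - l) * r + l * s)))"
    proof (rule brunn_minkowski_PiM[OF l])
      fix x y assume "x \<in> pre (cap r)" "y \<in> pre (cap s)"
      then have xy: "zero_ext n x \<in> K" "r \<le> dot_upto n (zero_ext n x) u"
        "zero_ext n y \<in> K" "s \<le> dot_upto n (zero_ext n y) u"
        by (auto simp: pre_def cap_def)
      let ?z = "\<lambda>i\<in>{..<n}. (1 - l) * x i + l * y i"
      have z: "zero_ext n ?z = (\<lambda>i. (1 - l) * zero_ext n x i + l * zero_ext n y i)"
        by (auto simp: zero_ext_def)
      have "(1 - l) * r + l * s \<le> dot_upto n (zero_ext n ?z) u"
        unfolding z dot_upto_combination using xy l by (intro add_mono mult_left_mono) auto
      moreover have "zero_ext n ?z \<in> K" unfolding z using combination_K xy l by auto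
      ultimately show "?z \<in> pre (cap ((1 - l) * r + l * s))"
        by (auto simp: pre_def cap_def space_PiM)
    qed (rule pre_sets[OF cap] box)+
    then have "(measure P (pre (cap r)) powr (1 - l) * measure P (pre (cap s)) powr l) / ?V
        \<le> measure P (pre (cap ((1 - l) * r + l * s))) / ?V"
      using volume_pos_real by (intro divide_right_mono) auto
    moreover have "?V = ?V powr (1 - l) * ?V powr l"
      using volume_pos_real by (simp flip: powr_add)
    ultimately show "?F r powr (1 - l) * ?F s powr l \<le> ?F ((1 - l) * r + l * s)"
      unfolding F using volume_pos_real by (simp add: powr_divide)
  qed
  then show ?thesis by simp
qed

text \<open>
  The homothety with ratio \<open>1 - t\<close> towards \<open>p\<close> maps the half of \<open>K\<close> on the positive side of
  the hyperplane through the centroid into the cap.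
\<close>

lemma cap_measure_ge:
  assumes "centered n K" and t: "0 \<le> t" "t < 1" and p: "p \<in> K"
  shows "exp (-1) * (1 - t) ^ n \<le> measure \<mu> {y. t * dot_upto n p u \<le> dot_upto n y u}"
proof -
  let ?V = "measure (lborel_Rn n) K"
  define A where "A = K \<inter> {y. 0 \<le> dot_upto n y u}"
  define C where "C = K \<inter> {y. t * dot_upto n p u \<le> dot_upto n y u}"
  have [measurable]: "{y. c \<le> dot_upto n y u} \<in> sets borel" for c by measurable
  have AC: "A \<in> sets borel" "C \<in> sets borel" unfolding A_def C_def by measurable
  have fin: "pre X \<in> fmeasurable P" if "X \<in> sets borel" "X \<subseteq> K" for X
  proof -
    have "emeasure P (pre X) \<le> emeasure P (pre K)"
      using that by (intro emeasure_mono pre_sets) (auto simp: pre_def)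
    then show ?thesis
      using volume_finite emeasure_lborel_Rn[OF borel_K] that
      by (intro fmeasurableI pre_sets) (auto intro: le_less_trans)
  qed
  have "pre A \<subseteq> {x\<in>space P. (\<lambda>i\<in>{..<n}. (1 - t) * x i + t * p i) \<in> pre C}"
  proof
    fix x assume "x \<in> pre A"
    then have x: "x \<in> space P" "zero_ext n x \<in> K" "0 \<le> dot_upto n (zero_ext n x) u"
      by (auto simp: pre_def A_def)
    let ?z = "\<lambda>i\<in>{..<n}. (1 - t) * x i + t * p i"
    have z: "zero_ext n ?z = (\<lambda>i. (1 - t) * zero_ext n x i + t * p i)"
      using zero_K[OF p] by (auto simp: zero_ext_def fun_eq_iff)
    have "zero_ext n ?z \<in> K" unfolding z using combination_K x p t by auto
    moreover have "t * dot_upto n p u \<le> dot_upto n (zero_ext n ?z) u"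
      unfolding z dot_upto_combination using x t by auto
    ultimately have "?z \<in> pre C" unfolding pre_def C_def by (simp add: space_PiM)
    then show "x \<in> {x\<in>space P. (\<lambda>i\<in>{..<n}. (1 - t) * x i + t * p i) \<in> pre C}"
      using x by simp
  qed
  moreover have "{x\<in>space P. (\<lambda>i\<in>{..<n}. (1 - t) * x i + t * p i) \<in> pre C} \<in> sets P"
  proof -
    have "(\<lambda>x. \<lambda>i\<in>{..<n}. (1 - t) * x i + t * p i) \<in> P \<rightarrow>\<^sub>M P"
      by (rule measurable_restrict) measurable
    from measurable_sets[OF this pre_sets[OF AC(2)]] show ?thesis
      by (rule back_subst[where P = "\<lambda>X. X \<in> sets P"]) auto
  qed
  ultimately have "emeasure P (pre A) \<le> emeasure P {x\<in>space P. (\<lambda>i\<in>{..<n}. (1 - t) * x i + t * p i) \<in> pre C}"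
    by (rule emeasure_mono)
  then have "ennreal ((1 - t) ^ n) * emeasure P (pre A) \<le>
      ennreal ((1 - t) ^ n) * emeasure P {x\<in>space P. (\<lambda>i\<in>{..<n}. (1 - t) * x i + t * p i) \<in> pre C}"
    by (rule mult_left_mono) simp
  also have "\<dots> = emeasure P (pre C)"
    using t by (intro emeasure_PiM_lborel_affine pre_sets AC) simp
  finally have "ennreal ((1 - t) ^ n) * emeasure P (pre A) \<le> emeasure P (pre C)" .
  then have "(1 - t) ^ n * measure P (pre A) \<le> measure P (pre C)"
  proof -
    have "emeasure P (pre A) = ennreal (measure P (pre A))" "emeasure P (pre C) = ennreal (measure P (pre C))"
      by (intro emeasure_eq_measure2 fin AC; simp add: A_def C_def)+
    then show ?thesis
      using \<open>ennreal ((1 - t) ^ n) * emeasure P (pre A) \<le> emeasure P (pre C)\<close> t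
      by (simp add: ennreal_mult[symmetric])
  qed
  then have "(1 - t) ^ n * (measure P (pre A) / ?V) \<le> measure P (pre C) / ?V"
    using volume_pos_real by (simp add: divide_right_mono)
  moreover have "measure P (pre A) / ?V = measure \<mu> {y. 0 \<le> dot_upto n y u}"
    "measure P (pre C) / ?V = measure \<mu> {y. t * dot_upto n p u \<le> dot_upto n y u}"
    unfolding A_def C_def by (rule measure_mu[symmetric]; measurable)+
  ultimately have "(1 - t) ^ n * measure \<mu> {y. 0 \<le> dot_upto n y u} \<le> measure \<mu> {y. t * dot_upto n p u \<le> dot_upto n y u}"
    by (simp only:)
  moreover have "exp (-1) * (1 - t) ^ n \<le> (1 - t) ^ n * measure \<mu> {y. 0 \<le> dot_upto n y u}"
    using halfspace_through_centroid[OF assms(1), of u] t by (simp add: mult.commute mult_left_mono)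
  ultimately show ?thesis by (rule order_trans[rotated])
qed

end

section \<open>Extreme rays and cross products\<close>

lemma dot_upto_combination_right:
  "dot_upto n x (\<lambda>i. a * u i + b * v i) = a * dot_upto n x u + b * dot_upto n x v"
  by (simp add: dot_upto_def sum.distrib sum_distrib_left algebra_simps)

lemma dot_upto_cong: "(\<And>i. i < n \<Longrightarrow> x i = x' i) \<Longrightarrow> (\<And>i. i < n \<Longrightarrow> y i = y' i) \<Longrightarrow>
    dot_upto n x y = dot_upto n x' y'"
  by (auto simp: dot_upto_def intro!: sum.cong)

lemma dot_upto_self_eq_0: "dot_upto n x x = 0 \<Longrightarrow> i < n \<Longrightarrow> x i = 0"
  by (auto simp: dot_upto_def sum_nonneg_eq_0_iff)

text \<open>This is the ratio test of the simplex method: move from \<open>w\<close> along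
  \<open>z\<close> until the first constraint with negative slope becomes tight. Constraints tight
  at \<open>w\<close> stay tight because they vanish on \<open>z\<close>, and \<open>k0\<close>
  guarantees that the motion stops.\<close>

lemma more_tight_constraints:
  fixes a :: "'k \<Rightarrow> nat \<Rightarrow> real"
  assumes "finite I" and feas: "\<And>k. k \<in> I \<Longrightarrow> 0 \<le> dot_upto d (a k) w"
    and ker: "\<And>k. k \<in> I \<Longrightarrow> dot_upto d (a k) w = 0 \<Longrightarrow> dot_upto d (a k) z = 0"
    and k0: "k0 \<in> I" "dot_upto d (a k0) z < 0"
  obtains \<tau> where "\<tau> > 0" "\<And>k. k \<in> I \<Longrightarrow> 0 \<le> dot_upto d (a k) (\<lambda>i. 1 * w i + \<tau> * z i)"
    "card {k\<in>I. dot_upto d (a k) w = 0} < card {k\<in>I. dot_upto d (a k) (\<lambda>i. 1 * w i + \<tau> * z i) = 0}"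
proof -
  let ?g = "\<lambda>k. dot_upto d (a k)"
  define A where "A = {k\<in>I. ?g k z < 0}"
  define \<tau> where "\<tau> = Min ((\<lambda>k. ?g k w / - ?g k z) ` A)"
  have A: "finite A" "A \<noteq> {}" using assms by (auto simp: A_def)
  have pos: "0 < ?g k w / - ?g k z" if "k \<in> A" for k
  proof (rule divide_pos_pos)
    show "0 < ?g k w" using that feas[of k] ker[of k] by (auto simp: A_def less_le)
  qed (use that in \<open>auto simp: A_def\<close>)
  have "\<tau> \<in> (\<lambda>k. ?g k w / - ?g k z) ` A" unfolding \<tau>_def using A by (intro Min_in) auto
  then obtain k1 where k1: "k1 \<in> A" "\<tau> = ?g k1 w / - ?g k1 z" by auto
  have \<tau>: "\<tau> > 0" using k1 pos by simp
  have le: "\<tau> \<le> ?g k w / - ?g k z" if "k \<in> A" for k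
    unfolding \<tau>_def using A that by (intro Min_le) auto
  have g: "?g k (\<lambda>i. 1 * w i + \<tau> * z i) = ?g k w + \<tau> * ?g k z" for k
    using dot_upto_combination_right[of d "a k" 1 w \<tau> z] by simp
  have nonneg: "0 \<le> ?g k w + \<tau> * ?g k z" if "k \<in> I" for k
  proof (cases "?g k z < 0")
    case True
    then have "k \<in> A" using that by (simp add: A_def)
    then show ?thesis using le[of k] True by (simp add: field_simps)
  next
    case False
    then show ?thesis using feas[OF that] \<tau> by simp
  qed
  have "?g k1 w + \<tau> * ?g k1 z = 0" "?g k1 w \<noteq> 0" "k1 \<in> I"
    using k1 pos[of k1] by (auto simp: A_def field_simps)
  then have "{k\<in>I. ?g k w = 0} \<subset> {k\<in>I. ?g k w + \<tau> * ?g k z = 0}"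
    using ker by auto
  then have "card {k\<in>I. ?g k w = 0} < card {k\<in>I. ?g k w + \<tau> * ?g k z = 0}"
    using assms(1) by (intro psubset_card_mono) auto
  then show ?thesis using that[OF \<tau>] nonneg by (simp only: g)
qed

text \<open>
  A pointed polyhedral cone is spanned by its extreme rays, so the complement of a convex cone
  which meets it contains an extreme ray.
\<close>

lemma extreme_ray_outside_convex_cone:
  fixes a :: "'k \<Rightarrow> nat \<Rightarrow> real"
  assumes "finite I"
    and pointed: "\<And>z i. (\<And>k. k \<in> I \<Longrightarrow> dot_upto d (a k) z = 0) \<Longrightarrow> i < d \<Longrightarrow> z i = 0"
    and Q: "\<And>u v \<alpha> \<gamma>. Q (\<lambda>i. \<alpha> * u i + \<gamma> * v i) \<Longrightarrow> 0 < \<alpha> \<Longrightarrow> 0 < \<gamma> \<Longrightarrow> Q u \<or> Q v"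
    and Q0: "\<And>w. Q w \<Longrightarrow> \<exists>i<d. w i \<noteq> 0"
    and ex: "\<And>k. k \<in> I \<Longrightarrow> 0 \<le> dot_upto d (a k) w0" "Q w0"
  obtains w where "\<And>k. k \<in> I \<Longrightarrow> 0 \<le> dot_upto d (a k) w" "Q w"
    "\<And>z. (\<And>k. k \<in> I \<Longrightarrow> dot_upto d (a k) w = 0 \<Longrightarrow> dot_upto d (a k) z = 0) \<Longrightarrow>
      \<exists>c. \<forall>i<d. z i = c * w i"
proof -
  let ?g = "\<lambda>k. dot_upto d (a k)"
  let ?S = "\<lambda>w. (\<forall>k\<in>I. 0 \<le> ?g k w) \<and> Q w"
  let ?T = "\<lambda>w. card {k\<in>I. ?g k w = 0}"
  \<comment> \<open>Among the feasible vectors satisfying \<open>Q\<close>, one with the largest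
    number of tight constraints spans an extreme ray.\<close>
  have "\<exists>w. ?S w \<and> (\<forall>v. ?S v \<longrightarrow> ?T v \<le> ?T w)"
  proof (rule ex_has_greatest_nat)
    show "?S w0" using ex by auto
    show "\<forall>v. ?S v \<longrightarrow> ?T v < Suc (card I)" using \<open>finite I\<close> by (auto simp: less_Suc_eq_le intro: card_mono)
  qed
  then obtain w where *: "?S w \<and> (\<forall>v. ?S v \<longrightarrow> ?T v \<le> ?T w)" ..
  then have w: "\<And>k. k \<in> I \<Longrightarrow> 0 \<le> ?g k w" "Q w" by simp_all
  have max: "?T v \<le> ?T w" if "\<And>k. k \<in> I \<Longrightarrow> 0 \<le> ?g k v" "Q v" for v
    using * that by simp
  have "\<exists>c. \<forall>i<d. z i = c * w i" if z: "\<And>k. k \<in> I \<Longrightarrow> ?g k w = 0 \<Longrightarrow> ?g k z = 0" for z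
  proof (rule ccontr)
    assume not: "\<nexists>c. \<forall>i<d. z i = c * w i"
    have sum_pos: "(\<Sum>k\<in>I. ?g k w) > 0"
    proof -
      have "(\<Sum>k\<in>I. ?g k w) \<noteq> 0"
      proof
        assume "(\<Sum>k\<in>I. ?g k w) = 0"
        then have "\<And>k. k \<in> I \<Longrightarrow> ?g k w = 0" using w(1) \<open>finite I\<close> by (simp add: sum_nonneg_eq_0_iff)
        then show False using pointed Q0[OF w(2)] by blast
      qed
      then show ?thesis using sum_nonneg[of I "\<lambda>k. ?g k w"] w(1) by (simp add: less_le)
    qed
    \<comment> \<open>Subtracting this multiple of \<open>w\<close> from \<open>z\<close> makes the
      row values sum to zero. They do not all vanish, so both signs occur, and moving from
      \<open>w\<close> along \<open>y\<close> as well as along \<open>- y\<close> meets a new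
      constraint.\<close>
    define c where "c = (\<Sum>k\<in>I. ?g k z) / (\<Sum>k\<in>I. ?g k w)"
    define y where "y = (\<lambda>i. 1 * z i + (- c) * w i)"
    have gy: "?g k y = ?g k z - c * ?g k w" for k
      unfolding y_def dot_upto_combination_right by simp
    have sum0: "(\<Sum>k\<in>I. ?g k y) = 0"
      unfolding gy sum_subtractf sum_distrib_left[symmetric] c_def using sum_pos by simp
    have kery: "?g k y = 0" if "k \<in> I" "?g k w = 0" for k
      using that z[OF that] by (simp add: gy)
    have "\<exists>k\<in>I. ?g k y \<noteq> 0"
    proof (rule ccontr)
      assume "\<not> (\<exists>k\<in>I. ?g k y \<noteq> 0)"
      then have "y i = 0" if "i < d" for i using pointed that by blast
      then have "\<forall>i<d. z i = c * w i" by (simp add: y_def)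
      then show False using not by blast
    qed
    have neg: "\<exists>k\<in>I. ?g k y < 0"
    proof (rule ccontr)
      assume "\<not> (\<exists>k\<in>I. ?g k y < 0)"
      then have "\<And>k. k \<in> I \<Longrightarrow> 0 \<le> ?g k y" by force
      then show False using sum0 \<open>\<exists>k\<in>I. ?g k y \<noteq> 0\<close> \<open>finite I\<close> sum_nonneg_eq_0_iff[of I "\<lambda>k. ?g k y"] by auto
    qed
    have pos: "\<exists>k\<in>I. 0 < ?g k y"
    proof (rule ccontr)
      assume "\<not> (\<exists>k\<in>I. 0 < ?g k y)"
      then have "\<And>k. k \<in> I \<Longrightarrow> 0 \<le> - ?g k y" by force
      then show False using sum0 \<open>\<exists>k\<in>I. ?g k y \<noteq> 0\<close> \<open>finite I\<close> sum_nonneg_eq_0_iff[of I "\<lambda>k. - ?g k y"]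
        by (auto simp: sum_negf)
    qed
    define y' where "y' = (\<lambda>i. (-1) * y i + 0 * y i)"
    have gy': "?g k y' = - ?g k y" for k unfolding y'_def dot_upto_combination_right by simp
    obtain k0 where k0: "k0 \<in> I" "?g k0 y < 0" using neg by auto
    obtain s where s: "s > 0" "\<And>k. k \<in> I \<Longrightarrow> 0 \<le> ?g k (\<lambda>i. 1 * w i + s * y i)"
      "?T w < ?T (\<lambda>i. 1 * w i + s * y i)"
      by (rule more_tight_constraints[where w = w and z = y and a = a and d = d and I = I])
        (use \<open>finite I\<close> w(1) kery k0 in blast)+
    obtain k1 where k1: "k1 \<in> I" "?g k1 y' < 0" using pos by (auto simp: gy')
    have kery': "?g k y' = 0" if "k \<in> I" "?g k w = 0" for k using kery that by (simp add: gy')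
    obtain t where t: "t > 0" "\<And>k. k \<in> I \<Longrightarrow> 0 \<le> ?g k (\<lambda>i. 1 * w i + t * y' i)"
      "?T w < ?T (\<lambda>i. 1 * w i + t * y' i)"
      by (rule more_tight_constraints[where w = w and z = y' and a = a and d = d and I = I])
        (use \<open>finite I\<close> w(1) kery' k1 in blast)+
    \<comment> \<open>\<open>w\<close> is a positive combination of the two endpoints, so
      \<open>Q\<close> holds at one of them, which has more tight constraints than
      \<open>w\<close>.\<close>
    have "w = (\<lambda>i. (t / (s + t)) * (1 * w i + s * y i) + (s / (s + t)) * (1 * w i + t * y' i))"
    proof
      fix i
      have "(t / (s + t)) * (1 * w i + s * y i) + (s / (s + t)) * (1 * w i + t * y' i) = (s + t) * w i / (s + t)"
        by (simp add: y'_def add_divide_distrib[symmetric] algebra_simps)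
      then show "w i = (t / (s + t)) * (1 * w i + s * y i) + (s / (s + t)) * (1 * w i + t * y' i)"
        using s t by simp
    qed
    then have "Q (\<lambda>i. (t / (s + t)) * (1 * w i + s * y i) + (s / (s + t)) * (1 * w i + t * y' i))"
      using w(2) by simp
    then have "Q (\<lambda>i. 1 * w i + s * y i) \<or> Q (\<lambda>i. 1 * w i + t * y' i)"
      by (rule Q) (use s t in auto)
    then show False
      using max[of "\<lambda>i. 1 * w i + s * y i", OF s(2)] max[of "\<lambda>i. 1 * w i + t * y' i", OF t(2)] s(3) t(3)
      by linarith
  qed
  then show ?thesis using that[of w] w by blast
qed

section \<open>Determinants, kernels and cross products\<close>

lemma det_eq_0_iff_kernel:
  fixes f :: "nat \<Rightarrow> nat \<Rightarrow> real"
  shows "Determinant.det (mat d d (\<lambda>(r, j). f r j)) = 0 \<longleftrightarrow>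
    (\<exists>z. (\<exists>i<d. z i \<noteq> 0) \<and> (\<forall>r<d. dot_upto d (f r) z = 0))"
proof -
  let ?M = "mat d d (\<lambda>(r, j). f r j)"
  have mult: "(?M *\<^sub>v v) $ r = dot_upto d (f r) (\<lambda>i. v $ i)" if "v \<in> carrier_vec d" "r < d" for v r
    using that by (simp add: scalar_prod_def dot_upto_def atLeast0LessThan)
  have "Determinant.det ?M = 0 \<longleftrightarrow> (\<exists>v. v \<in> carrier_vec d \<and> v \<noteq> 0\<^sub>v d \<and> ?M *\<^sub>v v = 0\<^sub>v d)"
    by (rule det_0_iff_vec_prod_zero) simp
  also have "\<dots> \<longleftrightarrow> (\<exists>z. (\<exists>i<d. z i \<noteq> 0) \<and> (\<forall>r<d. dot_upto d (f r) z = 0))"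
  proof
    assume "\<exists>v. v \<in> carrier_vec d \<and> v \<noteq> 0\<^sub>v d \<and> ?M *\<^sub>v v = 0\<^sub>v d"
    then obtain v where v: "v \<in> carrier_vec d" "v \<noteq> 0\<^sub>v d" "?M *\<^sub>v v = 0\<^sub>v d" by blast
    have "dot_upto d (f r) (\<lambda>i. v $ i) = 0" if "r < d" for r
      using mult[OF v(1) that] v(3) that by simp
    moreover have "\<exists>i<d. v $ i \<noteq> 0"
    proof (rule ccontr)
      assume "\<not> (\<exists>i<d. v $ i \<noteq> 0)"
      then have "v = 0\<^sub>v d" using v(1) by (intro eq_vecI) auto
      then show False using v(2) by simp
    qed
    ultimately show "\<exists>z. (\<exists>i<d. z i \<noteq> 0) \<and> (\<forall>r<d. dot_upto d (f r) z = 0)" by blast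
  next
    assume "\<exists>z. (\<exists>i<d. z i \<noteq> 0) \<and> (\<forall>r<d. dot_upto d (f r) z = 0)"
    then obtain z i where z: "i < d" "z i \<noteq> 0" "\<And>r. r < d \<Longrightarrow> dot_upto d (f r) z = 0" by blast
    let ?v = "vec d z"
    have "?v \<noteq> 0\<^sub>v d" using z(1,2) by (metis index_vec index_zero_vec(1))
    moreover have "?M *\<^sub>v ?v = 0\<^sub>v d"
    proof (rule eq_vecI)
      fix r assume "r < dim_vec (0\<^sub>v d)"
      then have r: "r < d" by simp
      have "(?M *\<^sub>v ?v) $ r = dot_upto d (f r) (\<lambda>i. ?v $ i)" using mult r by simp
      also have "\<dots> = dot_upto d (f r) z" by (rule dot_upto_cong) auto
      finally show "(?M *\<^sub>v ?v) $ r = 0\<^sub>v d $ r" using z r by simp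
    qed simp
    ultimately show "\<exists>v. v \<in> carrier_vec d \<and> v \<noteq> 0\<^sub>v d \<and> ?M *\<^sub>v v = 0\<^sub>v d"
      by (intro exI[of _ ?v]) auto
  qed
  finally show ?thesis .
qed

text \<open>The generalised cross product of the \<open>n\<close> rows \<open>f 0, \<dots>, f (n - 1)\<close> in \<open>\<real>\<^sup>n\<^sup>+\<^sup>1\<close>.\<close>

definition cross_rows :: "nat \<Rightarrow> (nat \<Rightarrow> nat \<Rightarrow> real) \<Rightarrow> nat \<Rightarrow> real" where
  "cross_rows n f i =
     cofactor (mat (Suc n) (Suc n) (\<lambda>(r, j). if r = 0 then 0 else f (r - 1) j)) 0 i"

text \<open>Laplace expansion along row 0, whose entries the cofactors do not see: the cross product
  represents the linear form that puts \<open>w\<close> on top of the rows and takes the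
  determinant.\<close>

lemma dot_upto_cross_rows:
  "dot_upto (Suc n) w (cross_rows n f) =
    Determinant.det (mat (Suc n) (Suc n) (\<lambda>(r, j). (if r = 0 then w else f (r - 1)) j))"
proof -
  let ?M = "mat (Suc n) (Suc n) (\<lambda>(r, j). (if r = 0 then w else f (r - 1)) j)"
  have "mat_delete ?M 0 i = mat_delete (mat (Suc n) (Suc n) (\<lambda>(r, j). if r = 0 then 0 else f (r - 1) j)) 0 i" for i
    by (rule eq_matI) (auto simp: mat_delete_def)
  then have "cofactor ?M 0 i = cross_rows n f i" for i
    by (simp add: cofactor_def cross_rows_def)
  then show ?thesis
    by (subst laplace_expansion_row[of ?M "Suc n" 0]) (auto simp: dot_upto_def)
qed

lemma dot_upto_cross_rows_eq_0:
  assumes "r < n"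
  shows "dot_upto (Suc n) (f r) (cross_rows n f) = 0"
  unfolding dot_upto_cross_rows
proof (rule det_identical_rows[of _ "Suc n" 0 "Suc r"])
  show "Matrix.row (mat (Suc n) (Suc n) (\<lambda>(ra, j). (if ra = 0 then f r else f (ra - 1)) j)) 0 =
    Matrix.row (mat (Suc n) (Suc n) (\<lambda>(ra, j). (if ra = 0 then f r else f (ra - 1)) j)) (Suc r)"
    using assms by (intro eq_vecI) auto
qed (use assms in auto)

lemma borel_measurable_det:
  fixes f :: "'a \<Rightarrow> nat \<Rightarrow> nat \<Rightarrow> real"
  assumes "\<And>r j. r < d \<Longrightarrow> j < d \<Longrightarrow> (\<lambda>x. f x r j) \<in> borel_measurable M"
  shows "(\<lambda>x. Determinant.det (mat d d (\<lambda>(r, j). f x r j))) \<in> borel_measurable M"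
proof -
  have "Determinant.det (mat d d (\<lambda>(r, j). f x r j)) =
      (\<Sum>p | p permutes {0..<d}. signof p * (\<Prod>i = 0..<d. f x i (p i)))" for x
    by (subst det_def') (auto intro!: sum.cong prod.cong simp: permutes_in_image)
  moreover have "(\<lambda>x. \<Sum>p | p permutes {0..<d}. signof p * (\<Prod>i = 0..<d. f x i (p i))) \<in> borel_measurable M"
    using assms by (intro borel_measurable_sum borel_measurable_times borel_measurable_const borel_measurable_prod)
      (auto simp: permutes_in_image)
  ultimately show ?thesis by simp
qed

lemma borel_measurable_cross_rows:
  fixes f :: "'a \<Rightarrow> nat \<Rightarrow> nat \<Rightarrow> real"
  assumes "\<And>r j. r < n \<Longrightarrow> j \<le> n \<Longrightarrow> (\<lambda>x. f x r j) \<in> borel_measurable M" "i \<le> n"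
  shows "(\<lambda>x. cross_rows n (f x) i) \<in> borel_measurable M"
proof -
  have eq: "mat_delete (mat (Suc n) (Suc n) (\<lambda>(r, j). if r = 0 then 0 else f x (r - 1) j)) 0 i =
      mat n n (\<lambda>(r, j). f x r (if j < i then j else Suc j))" for x
    by (rule eq_matI) (auto simp: mat_delete_def)
  show ?thesis
    unfolding cross_rows_def cofactor_def eq
    by (intro borel_measurable_times borel_measurable_const borel_measurable_det assms) auto
qed

text \<open>\<open>J\<close> is a smallest set of tight rows whose common kernel still lies in the
  line of \<open>w\<close>. Fewer than \<open>n\<close> rows together with \<open>w\<close> have a
  nonzero common kernel vector in dimension \<open>n + 1\<close>. With more than \<open>n\<close>
  rows, all orthogonal to \<open>w\<close>, there is a linear dependence that makes some row
  redundant. The cross product of the remaining \<open>n\<close> rows then lies in the line of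
  \<open>w\<close> and is nonzero.\<close>

lemma extreme_ray_eq_cross_rows:
  fixes a :: "nat \<Rightarrow> nat \<Rightarrow> real"
  assumes "finite T" and w: "i0 \<le> n" "w i0 \<noteq> 0"
    and tight: "\<And>k. k \<in> T \<Longrightarrow> dot_upto (Suc n) (a k) w = 0"
    and ker: "\<And>z. (\<And>k. k \<in> T \<Longrightarrow> dot_upto (Suc n) (a k) z = 0) \<Longrightarrow> \<exists>c. \<forall>i<Suc n. z i = c * w i"
  obtains J c where "J \<subseteq> T" "card J = n" "c \<noteq> 0"
    "\<And>i. i \<le> n \<Longrightarrow> w i = c * cross_rows n (\<lambda>r. a (sorted_list_of_set J ! r)) i"
proof -
  let ?d = "Suc n"
  let ?good = "\<lambda>J. J \<subseteq> T \<and> (\<forall>z. (\<forall>k\<in>J. dot_upto ?d (a k) z = 0) \<longrightarrow> (\<exists>c. \<forall>i<?d. z i = c * w i))"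
  have "?good T" using ker by blast
  then obtain J where J: "?good J" and min: "\<And>J'. ?good J' \<Longrightarrow> card J \<le> card J'"
    using ex_has_least_nat[of ?good T card] by blast
  have finJ: "finite J" using J \<open>finite T\<close> finite_subset by blast
  define js where "js = sorted_list_of_set J"
  have js: "set js = J" "length js = card J" "distinct js" using finJ by (auto simp: js_def)
  \<comment> \<open>A multiple of \<open>w\<close> that is orthogonal to \<open>w\<close>
    vanishes.\<close>
  have kerJ: "z i = 0"
    if z: "\<And>k. k \<in> J \<Longrightarrow> dot_upto ?d (a k) z = 0" "dot_upto ?d w z = 0" and "i < ?d" for z i
  proof -
    obtain c where c: "\<And>i. i < ?d \<Longrightarrow> z i = c * w i" using J z(1) by blast
    have "dot_upto ?d z z = c * dot_upto ?d w z"
      unfolding dot_upto_def sum_distrib_left using c by (intro sum.cong) auto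
    then show ?thesis using z(2) dot_upto_self_eq_0[of ?d z i] \<open>i < ?d\<close> by simp
  qed
  have "card J \<ge> n"
  proof (rule ccontr)
    assume "\<not> card J \<ge> n"
    \<comment> \<open>The rows are padded with zeros to a square matrix; since
      \<open>card J < n\<close>, row \<open>n\<close> is zero.\<close>
    define f where "f r = (if r = 0 then w else if r - 1 < card J then a (js ! (r - 1)) else (\<lambda>_. 0))" for r
    have "Determinant.det (mat ?d ?d (\<lambda>(r, j). f r j)) = 0"
    proof -
      have "Determinant.det (transpose_mat (mat ?d ?d (\<lambda>(r, j). f r j))) = 0"
      proof -
        have "transpose_mat (mat ?d ?d (\<lambda>(r, j). f r j)) = mat ?d ?d (\<lambda>(r, j). f j r)"
          by (rule eq_matI) auto
        moreover have "dot_upto ?d (\<lambda>j. f j r) (\<lambda>j. if j = n then 1 else 0) = 0" for r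
          using \<open>\<not> card J \<ge> n\<close> by (auto simp: dot_upto_def f_def)
        ultimately show ?thesis
          using det_eq_0_iff_kernel[of ?d "\<lambda>r j. f j r"] by (auto intro!: exI[of _ "\<lambda>j. if j = n then 1 else 0"])
      qed
      then show ?thesis by (subst (asm) det_transpose[of _ ?d]) auto
    qed
    then obtain z i where z: "i < ?d" "z i \<noteq> 0" "\<And>r. r < ?d \<Longrightarrow> dot_upto ?d (f r) z = 0"
      using det_eq_0_iff_kernel[of ?d f] by blast
    have "dot_upto ?d (a k) z = 0" if "k \<in> J" for k
    proof -
      obtain r where "r < card J" "js ! r = k" using \<open>k \<in> J\<close> js by (metis in_set_conv_nth)
      then show ?thesis using z(3)[of "Suc r"] \<open>\<not> card J \<ge> n\<close> by (simp add: f_def)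
    qed
    moreover have "dot_upto ?d w z = 0" using z(3)[of 0] by (simp add: f_def)
    ultimately show False using kerJ z(1,2) by blast
  qed
  moreover have "card J \<le> n"
  proof (rule ccontr)
    assume "\<not> card J \<le> n"
    define f where "f r = a (js ! r)" for r
    have "Determinant.det (mat ?d ?d (\<lambda>(r, j). f r j)) = 0"
    proof -
      have "dot_upto ?d (f r) w = 0" if "r < ?d" for r
      proof -
        have "js ! r \<in> J" using that \<open>\<not> card J \<le> n\<close> js by (metis Suc_leI leI nth_mem order_less_le_trans)
        then show ?thesis using J tight by (auto simp: f_def)
      qed
      then show ?thesis using det_eq_0_iff_kernel[of ?d f] w by (metis less_Suc_eq_le)
    qed
    then have "Determinant.det (mat ?d ?d (\<lambda>(r, j). f j r)) = 0"
    proof -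
      have "transpose_mat (mat ?d ?d (\<lambda>(r, j). f r j)) = mat ?d ?d (\<lambda>(r, j). f j r)"
        by (rule eq_matI) auto
      then show ?thesis
        using \<open>Determinant.det (mat ?d ?d (\<lambda>(r, j). f r j)) = 0\<close> det_transpose[of "mat ?d ?d (\<lambda>(r, j). f r j)" ?d]
        by simp
    qed
    \<comment> \<open>\<open>y\<close> holds the coefficients of a linear dependence. Pairing it
      with a vector \<open>z\<close> that is orthogonal to every row of \<open>J\<close> except row
      \<open>k\<close> isolates the single term of \<open>k\<close>, which is nonzero.\<close>
    then obtain y r where y: "r < ?d" "y r \<noteq> 0" "\<And>i. i < ?d \<Longrightarrow> dot_upto ?d (\<lambda>j. f j i) y = 0"
      using det_eq_0_iff_kernel[of ?d "\<lambda>r j. f j r"] by blast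
    have r: "r < length js" using y(1) \<open>\<not> card J \<le> n\<close> js by linarith
    define k where "k = js ! r"
    have k: "k \<in> J" using r js by (auto simp: k_def)
    have "\<not> ?good (J - {k})"
    proof
      assume "?good (J - {k})"
      then have "card J \<le> card (J - {k})" by (rule min)
      then show False using k finJ by (metis card_Diff1_less leD)
    qed
    then obtain z where z: "\<And>k'. k' \<in> J \<Longrightarrow> k' \<noteq> k \<Longrightarrow> dot_upto ?d (a k') z = 0"
      "\<nexists>c. \<forall>i<?d. z i = c * w i" using J by blast
    then have zk: "dot_upto ?d (a k) z \<noteq> 0" using J by blast
    have "0 = (\<Sum>i<?d. dot_upto ?d (\<lambda>j. f j i) y * z i)" using y(3) by simp
    also have "\<dots> = (\<Sum>j<?d. y j * dot_upto ?d (f j) z)"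
      unfolding dot_upto_def sum_distrib_left sum_distrib_right
      by (subst sum.swap) (simp add: mult_ac)
    also have "\<dots> = (\<Sum>j<?d. if j = r then y r * dot_upto ?d (a k) z else 0)"
    proof (rule sum.cong)
      fix j assume "j \<in> {..<?d}"
      then have j: "j < length js" using \<open>\<not> card J \<le> n\<close> js by auto
      show "y j * dot_upto ?d (f j) z = (if j = r then y r * dot_upto ?d (a k) z else 0)"
      proof (cases "j = r")
        case False
        then have "js ! j \<noteq> k" using js(3) j r by (simp add: k_def nth_eq_iff_index_eq)
        then show ?thesis using z(1)[of "js ! j"] j js False by (auto simp: f_def)
      qed (simp add: f_def k_def)
    qed simp
    also have "\<dots> = y r * dot_upto ?d (a k) z" using y(1) by simp
    finally show False using y(2) zk by simp
  qed
  ultimately have card: "card J = n" by simp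
  define u where "u = cross_rows n (\<lambda>r. a (js ! r))"
  have "dot_upto ?d (a k) u = 0" if "k \<in> J" for k
  proof -
    obtain r where "r < n" "js ! r = k" using \<open>k \<in> J\<close> js card by (metis in_set_conv_nth)
    then show ?thesis using dot_upto_cross_rows_eq_0[of r n "\<lambda>r. a (js ! r)"] by (simp add: u_def)
  qed
  then obtain c where c: "\<And>i. i < ?d \<Longrightarrow> u i = c * w i" using J by blast
  \<comment> \<open>The value is the determinant of the rows of \<open>J\<close> with
    \<open>w\<close> on top; were it zero, some nonzero vector would be orthogonal to all of them,
    against \<open>kerJ\<close>.\<close>
  have "dot_upto ?d w u \<noteq> 0"
  proof
    assume "dot_upto ?d w u = 0"
    then have "Determinant.det (mat ?d ?d (\<lambda>(r, j). (if r = 0 then w else a (js ! (r - 1))) j)) = 0"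
      by (simp add: u_def dot_upto_cross_rows)
    then obtain z i where z: "i < ?d" "z i \<noteq> 0"
      "\<And>r. r < ?d \<Longrightarrow> dot_upto ?d (if r = 0 then w else a (js ! (r - 1))) z = 0"
      using det_eq_0_iff_kernel[of ?d "\<lambda>r. if r = 0 then w else a (js ! (r - 1))"] by blast
    have "dot_upto ?d (a k) z = 0" if "k \<in> J" for k
    proof -
      obtain r where "r < n" "js ! r = k" using \<open>k \<in> J\<close> js card by (metis in_set_conv_nth)
      then show ?thesis using z(3)[of "Suc r"] by simp
    qed
    moreover have "dot_upto ?d w z = 0" using z(3)[of 0] by simp
    ultimately show False using kerJ z(1,2) by blast
  qed
  then have "c \<noteq> 0" using c by (auto simp: dot_upto_def)
  then have "w i = inverse c * u i" if "i \<le> n" for i using c that by simp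
  then show ?thesis using that[of J "inverse c"] J card \<open>c \<noteq> 0\<close> by (auto simp: u_def js_def)
qed

section \<open>Convex hulls of finitely many points\<close>

definition point_comb :: "nat \<Rightarrow> (nat \<Rightarrow> nat \<Rightarrow> real) \<Rightarrow> (nat \<Rightarrow> real) \<Rightarrow> nat \<Rightarrow> real" where
  "point_comb N x l = (\<lambda>i. \<Sum>j<N. l j * x j i)"

text \<open>Fixing the entries from \<open>N\<close> on to zero makes the simplex a closed subset of
  a product of unit intervals, hence compact.\<close>

definition weights :: "nat \<Rightarrow> (nat \<Rightarrow> real) set" where
  "weights N = {l. (\<forall>j. 0 \<le> l j) \<and> (\<forall>j\<ge>N. l j = 0) \<and> (\<Sum>j<N. l j) = 1}"

lemma point_comb_eq_sum: "point_comb N x l = (\<Sum>j<N. l j *\<^sub>R x j)"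
proof
  fix i
  have "(\<Sum>j\<in>A. l j *\<^sub>R x j) i = (\<Sum>j\<in>A. l j * x j i)" if "finite A" for A
    using that by (induction A rule: finite_induct) auto
  then show "point_comb N x l i = (\<Sum>j<N. l j *\<^sub>R x j) i" by (simp add: point_comb_def)
qed

lemma convex_hull_eq_point_comb: "convex hull (x ` {..<N}) = point_comb N x ` weights N"
proof (rule hull_unique)
  show "x ` {..<N} \<subseteq> point_comb N x ` weights N"
  proof clarify
    fix j assume j: "j < N"
    have "x j = point_comb N x (\<lambda>k. if k = j then 1 else 0)"
      using j by (auto simp: point_comb_def if_distrib[of "\<lambda>a. a * _"] cong: if_cong)
    moreover have "(\<lambda>k. if k = j then 1 else 0) \<in> weights N" using j by (auto simp: weights_def)
    ultimately show "x j \<in> point_comb N x ` weights N" by blast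
  qed
  show "convex (point_comb N x ` weights N)"
  proof (rule convexI)
    fix p q :: "nat \<Rightarrow> real" and u v :: real
    assume "p \<in> point_comb N x ` weights N" "q \<in> point_comb N x ` weights N" and uv: "0 \<le> u" "0 \<le> v" "u + v = 1"
    then obtain l m where lm: "l \<in> weights N" "m \<in> weights N" "p = point_comb N x l" "q = point_comb N x m" by auto
    have "u *\<^sub>R p + v *\<^sub>R q = point_comb N x (\<lambda>j. u * l j + v * m j)"
      by (auto simp: lm point_comb_def sum_distrib_left sum.distrib algebra_simps)
    moreover have "(\<lambda>j. u * l j + v * m j) \<in> weights N"
      using lm(1,2) uv by (auto simp: weights_def sum.distrib sum_distrib_left[symmetric])
    ultimately show "u *\<^sub>R p + v *\<^sub>R q \<in> point_comb N x ` weights N" by blast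
  qed
  fix T assume T: "x ` {..<N} \<subseteq> T" "convex T"
  show "point_comb N x ` weights N \<subseteq> T"
  proof clarify
    fix l assume "l \<in> weights N"
    then show "point_comb N x l \<in> T"
      unfolding point_comb_eq_sum using T by (intro convex_sum) (auto simp: weights_def)
  qed
qed

lemma compact_weights: "compact (weights N)"
proof -
  have "compactin (product_topology (\<lambda>_. euclidean) UNIV) (\<Pi>\<^sub>E j\<in>(UNIV::nat set). {0..1::real})"
    by (simp add: compactin_PiE)
  then have "compact (\<Pi>\<^sub>E j\<in>(UNIV::nat set). {0..1::real})"
    by (simp add: euclidean_product_topology)
  moreover have "closed (weights N)"
  proof -
    have c: "continuous_on UNIV (\<lambda>l::nat \<Rightarrow> real. l j)" for j by (rule continuous_on_product_coordinates)
    have "weights N = (\<Inter>j. {l. 0 \<le> l j}) \<inter> (\<Inter>j\<in>{N..}. {l. l j = 0}) \<inter> {l. (\<Sum>j<N. l j) = 1}"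
      by (auto simp: weights_def)
    also have "closed \<dots>"
      by (intro closed_Int closed_INT ballI closed_Collect_le closed_Collect_eq continuous_on_sum c continuous_on_const)
    finally show ?thesis .
  qed
  moreover have "weights N \<subseteq> (\<Pi>\<^sub>E j\<in>UNIV. {0..1})"
  proof
    fix l assume l: "l \<in> weights N"
    have "l j \<le> 1" for j
    proof (cases "j < N")
      case True
      then have "l j \<le> (\<Sum>j<N. l j)" using l by (intro member_le_sum) (auto simp: weights_def)
      then show ?thesis using l by (simp add: weights_def)
    qed (use l in \<open>auto simp: weights_def\<close>)
    then show "l \<in> (\<Pi>\<^sub>E j\<in>UNIV. {0..1})" using l by (auto simp: weights_def)
  qed
  ultimately show ?thesis by (metis compact_Int_closed inf.absorb2)
qed

lemma continuous_on_point_comb: "continuous_on S (point_comb N x)"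
proof -
  have "continuous_on UNIV (point_comb N x)"
    unfolding point_comb_def
    by (intro continuous_on_coordinatewise_then_product continuous_on_sum continuous_on_mult_right
        continuous_on_product_coordinates)
  then show ?thesis by (rule continuous_on_subset) simp
qed

lemma compact_convex_hull_points: "compact (convex hull (x ` {..<N::nat}) :: (nat \<Rightarrow> real) set)"
  unfolding convex_hull_eq_point_comb
  by (intro compact_continuous_image continuous_on_point_comb compact_weights)

text \<open>The hull is closed, so it suffices that it contains a countable dense subset
  \<open>D\<close> of \<open>C\<close>. Membership of a point means approximability by combinations
  with weights from a countable dense subset \<open>L\<close> of the simplex, so only countable
  quantifiers remain.\<close>

lemma sets_subset_convex_hull:
  fixes C :: "(nat \<Rightarrow> real) set" and N :: nat
  assumes M: "sets M = sets borel"
  shows "{x\<in>space (\<Pi>\<^sub>M j\<in>{..<N}. M). C \<subseteq> convex hull (x ` {..<N})} \<in> sets (\<Pi>\<^sub>M j\<in>{..<N}. M)"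
proof -
  obtain D where D: "countable D" "D \<subseteq> C" "C \<subseteq> closure D" by (rule separable)
  obtain L where L: "countable L" "L \<subseteq> weights N" "weights N \<subseteq> closure L" by (rule separable)
  have closed: "closed (convex hull (x ` {..<N}))" for x :: "nat \<Rightarrow> nat \<Rightarrow> real"
    by (rule compact_imp_closed[OF compact_convex_hull_points])
  have iff: "v \<in> convex hull (x ` {..<N}) \<longleftrightarrow> v \<in> closure (point_comb N x ` L)" for v x
  proof
    assume "v \<in> convex hull (x ` {..<N})"
    then have "v \<in> point_comb N x ` closure L" using L(3) by (auto simp: convex_hull_eq_point_comb)
    also have "\<dots> \<subseteq> closure (point_comb N x ` L)"
      by (rule image_closure_subset[OF continuous_on_point_comb closed_closure closure_subset])
    finally show "v \<in> closure (point_comb N x ` L)" .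
  next
    have "closure (point_comb N x ` L) \<subseteq> convex hull (x ` {..<N})"
      using L(2) by (intro closure_minimal closed) (auto simp: convex_hull_eq_point_comb)
    then show "v \<in> closure (point_comb N x ` L) \<Longrightarrow> v \<in> convex hull (x ` {..<N})" by blast
  qed
  have "C \<subseteq> convex hull (x ` {..<N}) \<longleftrightarrow>
      (\<forall>v\<in>D. \<forall>k::nat. \<exists>l\<in>L. dist (point_comb N x l) v < inverse (real (Suc k)))" for x
  proof -
    have "C \<subseteq> convex hull (x ` {..<N}) \<longleftrightarrow> D \<subseteq> convex hull (x ` {..<N})"
      using D closure_minimal[OF _ closed] by blast
    also have "\<dots> \<longleftrightarrow> (\<forall>v\<in>D. \<forall>e>0. \<exists>l\<in>L. dist (point_comb N x l) v < e)"
      unfolding subset_eq iff closure_approachable by blast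
    also have "\<dots> \<longleftrightarrow> (\<forall>v\<in>D. \<forall>k::nat. \<exists>l\<in>L. dist (point_comb N x l) v < inverse (real (Suc k)))"
    proof (intro ball_cong refl iffI allI impI)
      fix v and e :: real assume "\<forall>k::nat. \<exists>l\<in>L. dist (point_comb N x l) v < inverse (real (Suc k))" "e > 0"
      moreover obtain k where "inverse (real (Suc k)) < e" using reals_Archimedean \<open>e > 0\<close> by blast
      ultimately show "\<exists>l\<in>L. dist (point_comb N x l) v < e" by (meson less_trans)
    qed auto
    finally show ?thesis .
  qed
  moreover have "{x\<in>space (\<Pi>\<^sub>M j\<in>{..<N}. M). \<forall>v\<in>D. \<forall>k::nat. \<exists>l\<in>L. dist (point_comb N x l) v < inverse (real (Suc k))}
      \<in> sets (\<Pi>\<^sub>M j\<in>{..<N}. M)"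
  proof -
    have comb: "(\<lambda>x. point_comb N x l) \<in> (\<Pi>\<^sub>M j\<in>{..<N}. M) \<rightarrow>\<^sub>M borel" for l
    proof (rule measurable_coordinatewise_then_product)
      fix i
      have "(\<lambda>y::nat \<Rightarrow> real. y i) \<in> M \<rightarrow>\<^sub>M borel"
        unfolding measurable_cong_sets[OF M refl] by (rule borel_measurable_coordinate)
      then have "(\<lambda>x. x j i) \<in> (\<Pi>\<^sub>M j\<in>{..<N}. M) \<rightarrow>\<^sub>M borel" if "j < N" for j
        using that by (intro measurable_compose[OF measurable_component_singleton]) auto
      then show "(\<lambda>x. point_comb N x l i) \<in> (\<Pi>\<^sub>M j\<in>{..<N}. M) \<rightarrow>\<^sub>M borel"
        unfolding point_comb_def by (intro borel_measurable_sum borel_measurable_times) auto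
    qed
    have [measurable]: "(\<lambda>x. dist (point_comb N x l) v) \<in> borel_measurable (\<Pi>\<^sub>M j\<in>{..<N}. M)" for l v
      by (rule measurable_compose[OF comb]) (intro borel_measurable_continuous_onI continuous_intros)
    show ?thesis
      using D(1) L(1) by measurable
  qed
  ultimately show ?thesis by simp
qed

text \<open>The normal \<open>u\<close> points from a nearest point \<open>p\<close> of the compact
  hull to \<open>v\<close>. The squared distance involves only the first \<open>n\<close>
  coordinates, which determine points here because \<open>v\<close> and the hull vanish from
  coordinate \<open>n\<close> on.\<close>

lemma separation_from_points:
  fixes x :: "nat \<Rightarrow> nat \<Rightarrow> real"
  assumes v: "v \<notin> convex hull (x ` {..<N})" and N: "0 < N"
    and zero: "\<And>i. n \<le> i \<Longrightarrow> v i = 0" "\<And>j i. j < N \<Longrightarrow> n \<le> i \<Longrightarrow> x j i = 0"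
  obtains u s where "\<And>j. j < N \<Longrightarrow> dot_upto n (x j) u \<le> s" "s < dot_upto n v u"
proof -
  let ?H = "convex hull (x ` {..<N})"
  define \<phi> where "\<phi> p = (\<Sum>i<n. (v i - p i)\<^sup>2)" for p :: "nat \<Rightarrow> real"
  have "continuous_on ?H \<phi>"
    unfolding \<phi>_def
    by (intro continuous_intros continuous_on_subset[OF continuous_on_product_coordinates]) auto
  moreover have "?H \<noteq> {}" using N by auto
  ultimately obtain p where p: "p \<in> ?H" "\<And>q. q \<in> ?H \<Longrightarrow> \<phi> p \<le> \<phi> q"
    using continuous_attains_inf[OF compact_convex_hull_points] by metis
  define u where "u i = v i - p i" for i
  have zp: "p i = 0" if "n \<le> i" for i
  proof -
    obtain l where "p = point_comb N x l" using p(1) by (auto simp: convex_hull_eq_point_comb)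
    then show ?thesis using zero(2) that by (simp add: point_comb_def)
  qed
  have upos: "dot_upto n u u > 0"
  proof -
    have "dot_upto n u u \<ge> 0" by (auto simp: dot_upto_def intro: sum_nonneg)
    moreover have "dot_upto n u u \<noteq> 0"
    proof
      assume "dot_upto n u u = 0"
      then have "u i = 0" if "i < n" for i using that by (auto simp: dot_upto_def sum_nonneg_eq_0_iff)
      then have "v i = p i" for i using zero(1) zp by (cases "i < n") (auto simp: u_def)
      then have "v = p" by auto
      then show False using p(1) v by simp
    qed
    ultimately show ?thesis by simp
  qed
  have sum_zero: "dot_upto n (\<lambda>i. q i - p i) u \<le> 0" if q: "q \<in> ?H" for q
  proof (rule ccontr)
    define c where "c = dot_upto n (\<lambda>i. q i - p i) u"
    define D where "D = (\<Sum>i<n. (q i - p i)\<^sup>2)"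
    assume "\<not> dot_upto n (\<lambda>i. q i - p i) u \<le> 0"
    then have c: "c > 0" by (simp add: c_def)
    have D: "D \<ge> 0" by (auto simp: D_def intro: sum_nonneg)
    \<comment> \<open>A step this short towards \<open>q\<close> keeps the quadratic term
      \<open>e * (e * D)\<close> below the linear gain \<open>2 * e * c\<close>; the summand 1
      avoids division by zero.\<close>
    define e where "e = min 1 (c / (D + 1))"
    have e: "0 < e" "e \<le> 1" using c D by (auto simp: e_def)
    have "e * D \<le> c / (D + 1) * D" using D by (intro mult_right_mono) (auto simp: e_def)
    also have "\<dots> \<le> c" using c D by (simp add: field_simps)
    finally have eD: "e * D \<le> c" .
    have "(1 - e) *\<^sub>R p + e *\<^sub>R q \<in> ?H"
      using p(1) q e by (intro convexD[OF convex_convex_hull]) auto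
    then have "\<phi> p \<le> \<phi> ((1 - e) *\<^sub>R p + e *\<^sub>R q)" by (rule p(2))
    also have "\<phi> ((1 - e) *\<^sub>R p + e *\<^sub>R q) = \<phi> p - 2 * e * c + e * (e * D)"
      unfolding \<phi>_def c_def D_def dot_upto_def u_def sum_distrib_left sum_subtractf[symmetric] sum.distrib[symmetric]
      by (intro sum.cong) (auto simp: power2_eq_square algebra_simps)
    finally have "2 * e * c \<le> e * (e * D)" by simp
    also have "\<dots> \<le> e * c" using eD e by (intro mult_left_mono) auto
    finally show False using e c by simp
  qed
  have diff: "dot_upto n (\<lambda>i. a i - b i) u = dot_upto n a u - dot_upto n b u" for a b
    by (simp add: dot_upto_def sum_subtractf algebra_simps)
  show ?thesis
  proof (rule that)
    show "dot_upto n (x j) u \<le> dot_upto n p u" if "j < N" for j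
      using sum_zero[of "x j"] that hull_inc[of "x j" "x ` {..<N}"] by (auto simp: diff)
    show "dot_upto n p u < dot_upto n v u"
      using upos diff[of v p] by (simp add: u_def[abs_def])
  qed
qed

section \<open>Facets of random polytopes\<close>

text \<open>
  A vector \<open>w\<close> in \<open>\<real>\<^sup>n\<^sup>+\<^sup>1\<close> encodes the half-space \<open>{y. dot_upto n y w \<le> w n}\<close>. Row \<open>k < N\<close> of the
  constraint system says that it contains \<open>x k\<close>; row \<open>N + i\<close> reads off the coordinate \<open>w i\<close>.
\<close>

definition constraint_row :: "nat \<Rightarrow> nat \<Rightarrow> (nat \<Rightarrow> nat \<Rightarrow> real) \<Rightarrow> nat \<Rightarrow> nat \<Rightarrow> real" where
  "constraint_row n N x k i =
     (if k < N then (if i < n then - x k i else 1) else (if i = k - N then 1 else 0))"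

text \<open>Half-spaces are unaffected by positive scaling, so of the unknown scalar on an extreme
  ray only the sign \<sigma> is kept; this leaves finitely many candidates. If the chosen rows are
  dependent, the vector is zero.\<close>

definition facet_normal :: "nat \<Rightarrow> nat \<Rightarrow> nat set \<Rightarrow> real \<Rightarrow> (nat \<Rightarrow> nat \<Rightarrow> real) \<Rightarrow> nat \<Rightarrow> real" where
  "facet_normal n N J \<sigma> x i =
     \<sigma> * cross_rows n (\<lambda>r. constraint_row n N x (sorted_list_of_set J ! r)) i"

lemma dot_constraint_row_point:
  "k < N \<Longrightarrow> dot_upto (Suc n) (constraint_row n N x k) w = w n - dot_upto n (x k) w"
  by (simp add: dot_upto_def constraint_row_def sum_negf)

lemma dot_constraint_row_unit:
  "N \<le> k \<Longrightarrow> k < N + n \<Longrightarrow> dot_upto (Suc n) (constraint_row n N x k) w = w (k - N)"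
  by (auto simp: dot_upto_def constraint_row_def if_distrib[of "\<lambda>a. a * _"] cong: if_cong)

text \<open>
  The sign constraints \<open>\<epsilon> i * u i \<ge> 0\<close>, with \<open>\<epsilon>\<close> read off the given \<open>u\<close>, make the cone of
  supporting half-spaces pointed even if the points do not affinely span the space.
\<close>

lemma separating_facet:
  fixes x :: "nat \<Rightarrow> nat \<Rightarrow> real"
  assumes N: "0 < N" and sep: "\<And>k. k < N \<Longrightarrow> dot_upto n (x k) u \<le> s"
    and y0: "y0 \<in> K" "s < t * dot_upto n y0 u"
  obtains J \<sigma> where "J \<subseteq> {..<N + n}" "card J = n" "\<sigma> \<in> {1, -1}"
    "\<exists>y\<in>K. facet_normal n N J \<sigma> x n < t * dot_upto n y (facet_normal n N J \<sigma> x)"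
    "\<forall>k<N. dot_upto n (x k) (facet_normal n N J \<sigma> x) \<le> facet_normal n N J \<sigma> x n"
proof -
  let ?d = "Suc n"
  let ?I = "{..<N + n}"
  let ?a = "constraint_row n N x"
  define \<epsilon> where "\<epsilon> k = (if N \<le> k \<and> u (k - N) < 0 then -1 else 1 :: real)" for k
  define b where "b k = (\<lambda>i. \<epsilon> k * ?a k i)" for k
  \<comment> \<open>\<open>Q w\<close> says that the half-space of \<open>w\<close> misses a point
    of \<open>t K\<close>; its negation describes a convex cone of vectors \<open>w\<close>.\<close>
  define Q where "Q w \<longleftrightarrow> (\<exists>y\<in>K. w n < t * dot_upto n y w)" for w
  have \<epsilon>: "\<epsilon> k \<noteq> 0" "k < N \<Longrightarrow> \<epsilon> k = 1" for k by (auto simp: \<epsilon>_def)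
  have b: "dot_upto ?d (b k) w = \<epsilon> k * dot_upto ?d (?a k) w" for k w
    unfolding b_def dot_upto_def sum_distrib_left by (simp only: mult.assoc)
  have b0: "dot_upto ?d (b k) w = 0 \<longleftrightarrow> dot_upto ?d (?a k) w = 0" for k w
    using \<epsilon> by (simp add: b)
  \<comment> \<open>The unit rows kill the first \<open>n\<close> coordinates, and then the row of
    point 0, present because \<open>N > 0\<close>, kills the offset.\<close>
  have pointed: "z i = 0" if z: "\<And>k. k \<in> ?I \<Longrightarrow> dot_upto ?d (b k) z = 0" and i: "i < ?d" for z i
  proof -
    have 1: "z i = 0" if "i < n" for i
      using z[of "N + i"] that dot_constraint_row_unit[of N "N + i" n x z] by (simp add: b0)
    have "z n = dot_upto n (x 0) z" using z[of 0] N dot_constraint_row_point[of 0 N n x z] by (simp add: b0)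
    also have "\<dots> = 0" using 1 by (simp add: dot_upto_def)
    finally show ?thesis using 1 i by (cases "i = n") auto
  qed
  define w0 where "w0 i = (if i = n then s else u i)" for i
  have w0: "dot_upto n z w0 = dot_upto n z u" for z by (rule dot_upto_cong) (auto simp: w0_def)
  have feas0: "0 \<le> dot_upto ?d (b k) w0" if "k \<in> ?I" for k
  proof (cases "k < N")
    case True
    then show ?thesis using sep[OF True] dot_constraint_row_point[OF True, of n x w0] \<epsilon>(2)[OF True]
      unfolding b w0 by (simp add: w0_def)
  next
    case False
    then show ?thesis using that dot_constraint_row_unit[of N k n x w0]
      unfolding b by (auto simp: \<epsilon>_def w0_def)
  qed
  have Q_combination: "Q v \<or> Q v'" if comb: "Q (\<lambda>i. \<alpha> * v i + \<gamma> * v' i)" "0 < \<alpha>" "0 < \<gamma>" for v v' \<alpha> \<gamma>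
  proof (rule ccontr)
    assume "\<not> (Q v \<or> Q v')"
    then have le: "t * dot_upto n y v \<le> v n" "t * dot_upto n y v' \<le> v' n" if "y \<in> K" for y
      using that unfolding Q_def by force+
    obtain y where y: "y \<in> K" "\<alpha> * v n + \<gamma> * v' n < t * (\<alpha> * dot_upto n y v + \<gamma> * dot_upto n y v')"
      using comb(1) unfolding Q_def dot_upto_combination_right by blast
    have "\<alpha> * (t * dot_upto n y v) + \<gamma> * (t * dot_upto n y v') \<le> \<alpha> * v n + \<gamma> * v' n"
      using le[OF y(1)] comb(2,3) by (intro add_mono mult_left_mono) auto
    then show False using y(2) by (simp add: algebra_simps)
  qed
  have Q_nonzero: "\<exists>i<?d. w i \<noteq> 0" if "Q w" for w
  proof (rule ccontr)
    assume "\<not> (\<exists>i<?d. w i \<noteq> 0)"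
    then show False using that by (auto simp: Q_def dot_upto_def)
  qed
  have Q0: "Q w0" unfolding Q_def w0 using y0 by (auto simp: w0_def)
  obtain w where w: "\<And>k. k \<in> ?I \<Longrightarrow> 0 \<le> dot_upto ?d (b k) w" "Q w"
    and ker: "\<And>z. (\<And>k. k \<in> ?I \<Longrightarrow> dot_upto ?d (b k) w = 0 \<Longrightarrow> dot_upto ?d (b k) z = 0) \<Longrightarrow>
      \<exists>c. \<forall>i<?d. z i = c * w i"
    by (rule extreme_ray_outside_convex_cone[where I = ?I and a = b and d = ?d and Q = Q and ?w0.0 = w0])
       (use pointed Q_combination Q_nonzero feas0 Q0 in \<open>blast+\<close>)
  \<comment> \<open>Tightness does not see the signs \<epsilon>, so the ray is expressed by the
    unsigned rows. The candidates thus do not depend on \<open>u\<close>, and no choice of orthant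
    enters their count.\<close>
  define T where "T = {k\<in>?I. dot_upto ?d (?a k) w = 0}"
  obtain i0 where i0: "i0 \<le> n" "w i0 \<noteq> 0" using Q_nonzero[OF w(2)] by (auto simp: less_Suc_eq_le)
  have kerT: "\<exists>c. \<forall>i<?d. z i = c * w i" if "\<And>k. k \<in> T \<Longrightarrow> dot_upto ?d (?a k) z = 0" for z
    using that by (intro ker) (auto simp: T_def b0)
  have "finite T" "\<And>k. k \<in> T \<Longrightarrow> dot_upto ?d (?a k) w = 0" by (auto simp: T_def)
  then obtain J c where J: "J \<subseteq> T" "card J = n" "c \<noteq> 0"
    "\<And>i. i \<le> n \<Longrightarrow> w i = c * cross_rows n (\<lambda>r. ?a (sorted_list_of_set J ! r)) i"
    using extreme_ray_eq_cross_rows[of T i0 n w ?a] i0 kerT by metis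
  define v where "v = facet_normal n N J (sgn c) x"
  have wv: "w i = \<bar>c\<bar> * v i" if "i \<le> n" for i
    using J(4)[OF that] J(3) by (simp add: v_def facet_normal_def mult.assoc[symmetric] abs_mult_sgn)
  have dot_wv: "dot_upto n z w = \<bar>c\<bar> * dot_upto n z v" for z
    unfolding dot_upto_def sum_distrib_left using wv by (intro sum.cong) (auto simp: mult_ac)
  show ?thesis
  proof (rule that[of J "sgn c"])
    show "J \<subseteq> ?I" using J(1) by (auto simp: T_def)
    show "sgn c \<in> {1, -1}" using J(3) by (auto simp: sgn_real_def)
    obtain y where "y \<in> K" "\<bar>c\<bar> * v n < \<bar>c\<bar> * (t * dot_upto n y v)"
      using w(2) wv[of n] by (auto simp: Q_def dot_wv algebra_simps)
    then show "\<exists>y\<in>K. facet_normal n N J (sgn c) x n < t * dot_upto n y (facet_normal n N J (sgn c) x)"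
      using J(3) by (auto simp: v_def)
    show "\<forall>k<N. dot_upto n (x k) (facet_normal n N J (sgn c) x) \<le> facet_normal n N J (sgn c) x n"
    proof (intro allI impI)
      fix k assume that: "k < N"
      have "0 \<le> w n - dot_upto n (x k) w"
        using w(1)[of k] that dot_constraint_row_point[OF that, of n x w] \<epsilon>(2)[OF that] by (simp add: b)
      then have "\<bar>c\<bar> * dot_upto n (x k) v \<le> \<bar>c\<bar> * v n" using wv[of n] by (simp add: dot_wv)
      then show "dot_upto n (x k) (facet_normal n N J (sgn c) x) \<le> facet_normal n N J (sgn c) x n"
        using J(3) by (simp add: v_def)
    qed
  qed (fact J(2))
qed

text \<open>This is the source of independence: the candidate is a function of the sample points
  indexed by \<open>J\<close> alone.\<close>

lemma facet_normal_cong: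
  assumes "\<And>k. k \<in> J \<Longrightarrow> k < N \<Longrightarrow> x k = x' k" "finite J" "card J = n"
  shows "facet_normal n N J \<sigma> x i = facet_normal n N J \<sigma> x' i"
proof -
  have row: "constraint_row n N x (sorted_list_of_set J ! r) j = constraint_row n N x' (sorted_list_of_set J ! r) j"
    if "r < n" for r j
  proof -
    have "sorted_list_of_set J ! r \<in> J"
      using nth_mem[of r "sorted_list_of_set J"] that assms(2,3) by simp
    then show ?thesis using assms(1) by (simp add: constraint_row_def)
  qed
  have "mat_delete (mat (Suc n) (Suc n) (\<lambda>(r, j). if r = 0 then 0 else constraint_row n N x (sorted_list_of_set J ! (r - 1)) j)) 0 i =
    mat_delete (mat (Suc n) (Suc n) (\<lambda>(r, j). if r = 0 then 0 else constraint_row n N x' (sorted_list_of_set J ! (r - 1)) j)) 0 i"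
    by (rule eq_matI) (auto simp: mat_delete_def row)
  then show ?thesis by (simp add: facet_normal_def cross_rows_def cofactor_def)
qed

lemma borel_measurable_facet_normal:
  assumes M: "sets M = sets borel" and "J \<subseteq> {..<N + n}" "card J = n" "i \<le> n"
  shows "(\<lambda>x. facet_normal n N J \<sigma> x i) \<in> borel_measurable (\<Pi>\<^sub>M j\<in>{..<N}. M)"
proof -
  have "(\<lambda>y::nat \<Rightarrow> real. y i) \<in> M \<rightarrow>\<^sub>M borel" for i
    unfolding measurable_cong_sets[OF M refl] by (rule borel_measurable_coordinate)
  then have comp: "(\<lambda>x. x k j) \<in> borel_measurable (\<Pi>\<^sub>M j\<in>{..<N}. M)" if "k < N" for k j
    using that by (intro measurable_compose[OF measurable_component_singleton]) auto
  have "(\<lambda>x. constraint_row n N x k j) \<in> borel_measurable (\<Pi>\<^sub>M j\<in>{..<N}. M)" for k j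
    using comp[of k j] by (cases "k < N") (auto simp: constraint_row_def)
  then show ?thesis
    unfolding facet_normal_def
    using assms(4) by (intro borel_measurable_times borel_measurable_const borel_measurable_cross_rows)
qed

section \<open>Facet events and the union bound\<close>

context Rn_body
begin

text \<open>Containment is asked only of the points outside \<open>J\<close>, which are independent
  of the candidate. The strict inequality also excludes the zero vector.\<close>

definition facet_event :: "nat \<Rightarrow> real \<Rightarrow> nat set \<Rightarrow> real \<Rightarrow> (nat \<Rightarrow> nat \<Rightarrow> real) set" where
  "facet_event N t J \<sigma> = {x\<in>space (uniform_points N n K).
     (\<exists>y\<in>K. facet_normal n N J \<sigma> x n < t * dot_upto n y (facet_normal n N J \<sigma> x)) \<and>
     (\<forall>k\<in>{..<N} - J. dot_upto n (x k) (facet_normal n N J \<sigma> x) \<le> facet_normal n N J \<sigma> x n)}"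

text \<open>The condition on \<open>y\<close> is open, so the existential over \<open>K\<close> may
  be restricted to a countable dense subset.\<close>

lemma sets_facet_event:
  assumes "J \<subseteq> {..<N + n}" "card J = n"
  shows "facet_event N t J \<sigma> \<in> sets (uniform_points N n K)"
proof -
  let ?w = "facet_normal n N J \<sigma>"
  obtain D where D: "countable D" "D \<subseteq> K" "K \<subseteq> closure D" by (rule separable)
  have dense: "(\<exists>y\<in>K. c < t * dot_upto n y u) \<longleftrightarrow> (\<exists>y\<in>D. c < t * dot_upto n y u)" for c u
  proof
    assume "\<exists>y\<in>K. c < t * dot_upto n y u"
    then obtain y where y: "y \<in> closure D" "c < t * dot_upto n y u" using D by auto
    have "open {y. c < t * dot_upto n y u}"
      unfolding dot_upto_def
      by (intro open_Collect_less continuous_intros continuous_on_subset[OF continuous_on_product_coordinates]) auto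
    then have "{y. c < t * dot_upto n y u} \<inter> D \<noteq> {}"
      using y open_Int_closure_eq_empty[of "{y. c < t * dot_upto n y u}" D] by auto
    then show "\<exists>y\<in>D. c < t * dot_upto n y u" by auto
  qed (use D in auto)
  have fixed: "(\<lambda>x. dot_upto n y (?w x)) \<in> borel_measurable (\<Pi>\<^sub>M j\<in>{..<N}. \<mu>)" for y
    unfolding dot_upto_def by (intro borel_measurable_sum borel_measurable_times borel_measurable_const borel_measurable_facet_normal sets_mu assms) auto
  have point: "(\<lambda>x. dot_upto n (x k) (?w x)) \<in> borel_measurable (\<Pi>\<^sub>M j\<in>{..<N}. \<mu>)" if "k \<in> {..<N} - J" for k
  proof -
    have "(\<lambda>y::nat \<Rightarrow> real. y i) \<in> \<mu> \<rightarrow>\<^sub>M borel" for i by measurable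
    then have "(\<lambda>x. x k j) \<in> borel_measurable (\<Pi>\<^sub>M j\<in>{..<N}. \<mu>)" for j
      using that by (intro measurable_compose[OF measurable_component_singleton]) auto
    then show ?thesis unfolding dot_upto_def
      by (intro borel_measurable_sum borel_measurable_times borel_measurable_facet_normal sets_mu assms) auto
  qed
  have last: "(\<lambda>x. ?w x n) \<in> borel_measurable (\<Pi>\<^sub>M j\<in>{..<N}. \<mu>)"
    by (intro borel_measurable_facet_normal sets_mu assms) auto
  show ?thesis
    unfolding facet_event_def uniform_points_def dense using D(1)
    by (intro sets.sets_Collect_conj sets.sets_Collect_countable_Ex' sets.sets_Collect_finite_All
        borel_measurable_less borel_measurable_le borel_measurable_times borel_measurable_const
        fixed point last) auto
qed

text \<open>Once the points indexed by \<open>A\<close> are fixed, so is the half-space. Either it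
  misses no point of \<open>t K\<close> and the slice is empty, or each remaining point must avoid a
  cap. At least \<open>N - n\<close> points remain; there may be more, as \<open>J\<close> can also
  contain indices of unit rows.\<close>

lemma prob_facet_event_le:
  assumes cent: "centered n K" and t: "0 \<le> t" "t < 1" and J: "J \<subseteq> {..<N + n}" "card J = n"
  shows "measure (uniform_points N n K) (facet_event N t J \<sigma>) \<le> (1 - exp (-1) * (1 - t) ^ n) ^ (N - n)"
proof -
  let ?w = "facet_normal n N J \<sigma>"
  let ?q = "1 - exp (-1) * (1 - t) ^ n"
  interpret product_prob_space "\<lambda>_::nat. \<mu>" by standard
  define A where "A = {..<N} \<inter> J"
  define B where "B = {..<N} - J"
  have AB: "A \<inter> B = {}" "finite A" "finite B" "A \<union> B = {..<N}" by (auto simp: A_def B_def)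
  have finJ: "finite J" using J(1) finite_subset by blast
  have q: "0 \<le> ?q" "?q \<le> 1"
  proof -
    have "exp (-1) * (1 - t) ^ n \<le> 1 * 1" using t by (intro mult_mono power_le_one) auto
    then show "0 \<le> ?q" by simp
    show "?q \<le> 1" using t by simp
  qed
  interpret U: prob_space "uniform_points N n K"
    unfolding uniform_points_def by (rule prob_space_PiM) (rule mu.prob_space_axioms)
  have "N - n \<le> card B"
  proof -
    have "card B \<ge> card {..<N} - card J" unfolding B_def by (rule diff_card_le_card_Diff[OF finJ])
    then show ?thesis using J(2) by simp
  qed
  then have powB: "?q ^ card B \<le> ?q ^ (N - n)" using q by (intro power_decreasing) auto
  have slice: "emeasure (\<Pi>\<^sub>M j\<in>B. \<mu>) ((\<lambda>y. merge A B (x, y)) -` facet_event N t J \<sigma> \<inter> space (\<Pi>\<^sub>M j\<in>B. \<mu>))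
      \<le> ennreal (?q ^ (N - n))" for x
  proof (cases "\<exists>y\<in>K. ?w x n < t * dot_upto n y (?w x)")
    case False
    have "?w (merge A B (x, z)) = ?w x" for z
      by (intro ext facet_normal_cong finJ J(2)) (auto simp: merge_def A_def)
    then have "(\<lambda>y. merge A B (x, y)) -` facet_event N t J \<sigma> \<inter> space (\<Pi>\<^sub>M j\<in>B. \<mu>) = {}"
      using False by (auto simp: facet_event_def)
    then show ?thesis by simp
  next
    case True
    then obtain y where y: "y \<in> K" "?w x n < t * dot_upto n y (?w x)" by auto
    define H where "H = {z. dot_upto n z (?w x) \<le> ?w x n}"
    have w_eq: "?w (merge A B (x, z)) = ?w x" for z
      by (intro ext facet_normal_cong finJ J(2)) (auto simp: merge_def A_def)
    have [measurable]: "H \<in> sets borel" unfolding H_def by measurable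
    have "(\<lambda>z. merge A B (x, z)) -` facet_event N t J \<sigma> \<inter> space (\<Pi>\<^sub>M j\<in>B. \<mu>) \<subseteq> (\<Pi>\<^sub>E j\<in>B. H)"
    proof
      fix z assume z: "z \<in> (\<lambda>z. merge A B (x, z)) -` facet_event N t J \<sigma> \<inter> space (\<Pi>\<^sub>M j\<in>B. \<mu>)"
      then have "z \<in> extensional B" by (auto simp: space_PiM PiE_iff)
      moreover have "z k \<in> H" if k: "k \<in> B" for k
      proof -
        have "dot_upto n (merge A B (x, z) k) (?w (merge A B (x, z))) \<le> ?w (merge A B (x, z)) n"
          using z k by (auto simp: facet_event_def B_def)
        moreover have "merge A B (x, z) k = z k" using k AB(1) by (auto simp: merge_def)
        ultimately show ?thesis by (simp add: w_eq H_def)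
      qed
      ultimately show "z \<in> (\<Pi>\<^sub>E j\<in>B. H)" by (auto simp: PiE_iff)
    qed
    then have "emeasure (\<Pi>\<^sub>M j\<in>B. \<mu>) ((\<lambda>z. merge A B (x, z)) -` facet_event N t J \<sigma> \<inter> space (\<Pi>\<^sub>M j\<in>B. \<mu>))
        \<le> emeasure (\<Pi>\<^sub>M j\<in>B. \<mu>) (\<Pi>\<^sub>E j\<in>B. H)"
      using AB by (intro emeasure_mono sets_PiM_I_finite) auto
    also have "\<dots> = (\<Prod>j\<in>B. emeasure \<mu> H)" using AB by (intro emeasure_PiM) auto
    also have "\<dots> = ennreal (measure \<mu> H ^ card B)"
      unfolding mu.emeasure_eq_measure by (simp add: ennreal_power)
    also have "\<dots> \<le> ennreal (?q ^ card B)"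
    proof (intro ennreal_leI power_mono)
      let ?C = "{z. t * dot_upto n y (?w x) \<le> dot_upto n z (?w x)}"
      have [measurable]: "?C \<in> sets borel" by measurable
      \<comment> \<open>The strict inequality at \<open>y\<close> makes the half-space and the cap
        at height \<open>t * dot_upto n y (?w x)\<close> disjoint.\<close>
      have "measure \<mu> H + measure \<mu> ?C = measure \<mu> (H \<union> ?C)"
        using y(2) by (intro mu.finite_measure_Union[symmetric]) (auto simp: H_def)
      also have "\<dots> \<le> 1" by simp
      finally show "measure \<mu> H \<le> ?q" using cap_measure_ge[OF cent t y(1), of "?w x"] by linarith
    qed simp
    also have "\<dots> \<le> ennreal (?q ^ (N - n))" using powB by (rule ennreal_leI)
    finally show ?thesis .
  qed
  have "emeasure (uniform_points N n K) (facet_event N t J \<sigma>) =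
      (\<integral>\<^sup>+x. emeasure (\<Pi>\<^sub>M j\<in>B. \<mu>) ((\<lambda>y. merge A B (x, y)) -` facet_event N t J \<sigma> \<inter> space (\<Pi>\<^sub>M j\<in>B. \<mu>)) \<partial>(\<Pi>\<^sub>M j\<in>A. \<mu>))"
    using emeasure_fold_integral[OF AB(1,2,3), of "facet_event N t J \<sigma>"] sets_facet_event[OF J]
    unfolding AB(4) uniform_points_def by simp
  also have "\<dots> \<le> (\<integral>\<^sup>+x. ennreal (?q ^ (N - n)) \<partial>(\<Pi>\<^sub>M j\<in>A. \<mu>))"
    by (intro nn_integral_mono slice)
  also have "\<dots> = ennreal (?q ^ (N - n))"
  proof -
    interpret A: prob_space "\<Pi>\<^sub>M j\<in>A. \<mu>" by (rule prob_space_PiM) (rule mu.prob_space_axioms)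
    show ?thesis by (simp add: A.emeasure_space_1)
  qed
  finally show ?thesis
    using q by (simp add: U.emeasure_eq_measure)
qed

lemma prob_scaled_body_in_hull_ge:
  assumes cent: "centered n K" and t: "0 \<le> t" "t < 1" and N: "0 < N"
  shows "1 - 2 * real ((N + n) choose n) * (1 - exp (-1) * (1 - t) ^ n) ^ (N - n)
    \<le> \<P>(x in uniform_points N n K. (\<lambda>v. t *\<^sub>R v) ` K \<subseteq> convex hull (x ` {..<N}))"
proof -
  let ?U = "uniform_points N n K"
  let ?q = "1 - exp (-1) * (1 - t) ^ n"
  let ?S = "{x\<in>space ?U. (\<lambda>v. t *\<^sub>R v) ` K \<subseteq> convex hull (x ` {..<N})}"
  interpret U: prob_space ?U
    unfolding uniform_points_def by (rule prob_space_PiM) (rule mu.prob_space_axioms)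
  have S: "?S \<in> sets ?U" unfolding uniform_points_def by (rule sets_subset_convex_hull[OF sets_mu])
  define \<J> where "\<J> = {J. J \<subseteq> {..<N + n} \<and> card J = n} \<times> {1, -1 :: real}"
  have "card {J. J \<subseteq> {..<N + n} \<and> card J = n} = (N + n) choose n" using n_subsets[of "{..<N + n}" n] by simp
  then have \<J>: "finite \<J>" "card \<J> = 2 * ((N + n) choose n)"
    by (auto simp: \<J>_def card_cartesian_product)
  have ev: "facet_event N t (fst p) (snd p) \<in> U.events" if "p \<in> \<J>" for p
    using that by (intro sets_facet_event) (auto simp: \<J>_def)
  have "AE x in ?U. \<forall>j\<in>{..<N}. x j \<in> K"
  proof (rule AE_finite_allI)
    show "AE x in ?U. x j \<in> K" if "j \<in> {..<N}" for j
      unfolding uniform_points_def using that by (intro AE_PiM_component mu.prob_space_axioms AE_mu_K)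
  qed simp
  \<comment> \<open>Only almost surely do the sample points lie in \<open>K\<close>, which gives the
    vanishing from coordinate \<open>n\<close> on that separation requires.\<close>
  then have "AE x in ?U. x \<in> space ?U - ?S \<longrightarrow> x \<in> (\<Union>p\<in>\<J>. facet_event N t (fst p) (snd p))"
  proof eventually_elim
    case (elim x)
    show ?case
    proof
      assume x: "x \<in> space ?U - ?S"
      then obtain v where v: "v \<in> K" "t *\<^sub>R v \<notin> convex hull (x ` {..<N})" by auto
      obtain u s where us: "\<And>j. j < N \<Longrightarrow> dot_upto n (x j) u \<le> s" "s < dot_upto n (t *\<^sub>R v) u"
        by (rule separation_from_points[OF v(2) N, of n]) (use zero_K v(1) elim in auto)
      have "dot_upto n (t *\<^sub>R v) u = t * dot_upto n v u"
        by (simp add: dot_upto_def sum_distrib_left mult.assoc)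
      then have sep: "s < t * dot_upto n v u" using us(2) by simp
      obtain J \<sigma> where J: "J \<subseteq> {..<N + n}" "card J = n" "\<sigma> \<in> {1, -1}"
        "\<exists>y\<in>K. facet_normal n N J \<sigma> x n < t * dot_upto n y (facet_normal n N J \<sigma> x)"
        "\<forall>k<N. dot_upto n (x k) (facet_normal n N J \<sigma> x) \<le> facet_normal n N J \<sigma> x n"
        by (rule separating_facet[where x = x and u = u and s = s and n = n, OF N us(1) v(1) sep])
      then have "x \<in> facet_event N t J \<sigma>" using x by (auto simp: facet_event_def)
      moreover have "(J, \<sigma>) \<in> \<J>" using J by (auto simp: \<J>_def)
      ultimately show "x \<in> (\<Union>p\<in>\<J>. facet_event N t (fst p) (snd p))" by force
    qed
  qed
  then have "U.prob (space ?U - ?S) \<le> U.prob (\<Union>p\<in>\<J>. facet_event N t (fst p) (snd p))"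
    using ev \<J>(1) by (intro U.finite_measure_mono_AE sets.finite_UN) auto
  also have "\<dots> \<le> (\<Sum>p\<in>\<J>. U.prob (facet_event N t (fst p) (snd p)))"
    using ev \<J>(1) by (intro U.finite_measure_subadditive_finite) auto
  also have "\<dots> \<le> (\<Sum>p\<in>\<J>. ?q ^ (N - n))"
    by (intro sum_mono prob_facet_event_le[OF cent t]) (auto simp: \<J>_def)
  also have "\<dots> = 2 * real ((N + n) choose n) * ?q ^ (N - n)" using \<J>(2) by simp
  finally show ?thesis using U.prob_compl[OF S] by simp
qed

end

section \<open>Choice of the constants\<close>

text \<open>The right side grows like \<open>m powr (1 - \<beta> / 2)\<close>. Of the summand 2, one
  unit absorbs the factor 2 for the sign and the other comes from the binomial bound.\<close>

lemma eventually_facet_count_dominated: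
  fixes \<beta> :: real
  assumes "0 < \<beta>" "\<beta> < 1"
  shows "\<forall>\<^sub>F m in at_top. 2 + ln (m + 1) + m powr (1 - \<beta>) < exp (-1) * m powr (- \<beta> / 2) * (m - 1)"
proof -
  have "exp (-1 :: real) > 0" by simp
  then show ?thesis using assms by real_asymp
qed

text \<open>A single term of the exponential series gives \<open>n ^ n \<le> exp n * fact n\<close>,
  and the binomial coefficient is at most \<open>(N + n) ^ n / fact n\<close>.\<close>

lemma binomial_le_exp_power:
  assumes "0 < n"
  shows "real ((N + n) choose n) \<le> exp (real n * (1 + ln (real N / real n + 1)))"
proof -
  have "real n ^ n / fact n \<le> exp (real n)"
  proof -
    have s: "(\<lambda>k. real n ^ k / fact k) sums exp (real n)"
      using exp_converges[of "real n"] by (simp add: field_simps)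
    have "(\<Sum>k\<in>{n}. real n ^ k / fact k) \<le> (\<Sum>k. real n ^ k / fact k)"
      using s by (intro sum_le_suminf) (auto simp: sums_iff)
    then show ?thesis using s by (simp add: sums_iff)
  qed
  then have fact_le: "real n ^ n \<le> exp (real n) * fact n" by (simp add: field_simps)
  have pos: "real N / real n + 1 > 0" by (simp add: add_nonneg_pos)
  have "real ((N + n) choose n) * fact n \<le> real (N + n) ^ n"
    by (metis binomial_fact_pow of_nat_fact of_nat_le_iff of_nat_mult of_nat_power)
  also have "\<dots> = (real N / real n + 1) ^ n * real n ^ n"
    using assms by (simp add: power_mult_distrib[symmetric] field_simps)
  also have "\<dots> \<le> (real N / real n + 1) ^ n * (exp (real n) * fact n)"
    using fact_le pos by (intro mult_left_mono) auto
  finally have "real ((N + n) choose n) \<le> (real N / real n + 1) ^ n * exp (real n)"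
    by (simp add: mult.assoc[symmetric])
  also have "\<dots> = exp (real n * (1 + ln (real N / real n + 1)))"
    using pos by (simp add: distrib_left exp_add exp_of_nat_mult)
  finally show ?thesis .
qed

text \<open>The factor 1/4 in \<open>t\<close> keeps \<open>t \<le> 1 / 4\<close>, where
  \<open>ln (1 - t) \<ge> - 2 * t\<close>. Hence \<open>(1 - t) ^ n\<close> is at least
  \<open>m powr (- \<beta> / 2)\<close>, and after division by \<open>n\<close> the comparison of
  exponents follows from \<open>dom\<close>.\<close>

lemma failure_bound_lt:
  fixes \<beta> :: real
  assumes \<beta>: "0 < \<beta>" "\<beta> < 1" and n: "1 \<le> n" and N: "real n < real N" "real N \<le> exp (real n)"
  defines "m \<equiv> real N / real n"
  assumes dom: "2 + ln (m + 1) + m powr (1 - \<beta>) < exp (-1) * m powr (- \<beta> / 2) * (m - 1)"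
  defines "t \<equiv> 1 / 4 * \<beta> * ln m / real n"
  shows "0 \<le> t" "t < 1"
    "2 * real ((N + n) choose n) * (1 - exp (-1) * (1 - t) ^ n) ^ (N - n)
      < exp (- (real N powr (1 - \<beta>) * real n powr \<beta>))"
proof -
  have n0: "0 < real n" using n by simp
  have m1: "m > 1" using N n0 by (simp add: m_def)
  show t0: "0 \<le> t" using \<beta> m1 by (simp add: t_def)
  \<comment> \<open>Here the upper bound \<open>N \<le> exp n\<close> enters: it makes
    \<open>t\<close> small however large \<open>N / n\<close> is.\<close>
  have "ln m \<le> real n"
  proof -
    have "m \<le> real N" using n by (simp add: m_def divide_le_eq mult_le_cancel_left1)
    also have "\<dots> \<le> exp (real n)" by fact
    finally have "ln m \<le> ln (exp (real n))" using m1 by (intro ln_mono) auto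
    then show ?thesis by simp
  qed
  then have "\<beta> * ln m \<le> 1 * real n" using \<beta> m1 by (intro mult_mono) auto
  then have t4: "t \<le> 1 / 4" using n0 by (simp add: t_def divide_le_eq)
  then show "t < 1" by simp
  have q_ge: "m powr (- \<beta> / 2) \<le> (1 - t) ^ n"
  proof -
    have "- (2 * t) \<le> ln (1 - t)"
    proof -
      have "- t - 2 * t\<^sup>2 \<le> ln (1 - t)" using t0 t4 by (intro ln_one_minus_pos_lower_bound) auto
      moreover have "2 * t\<^sup>2 \<le> t" using t0 t4 mult_right_mono[of t "1/2" t] by (simp add: power2_eq_square)
      ultimately show ?thesis by linarith
    qed
    have "m powr (- \<beta> / 2) = exp (real n * (- (2 * t)))"
      using m1 n0 by (simp add: powr_def t_def)
    also have "\<dots> \<le> exp (real n * ln (1 - t))"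
      using \<open>- (2 * t) \<le> ln (1 - t)\<close> by (simp only: exp_le_cancel_iff mult_left_mono of_nat_0_le_iff)
    also have "\<dots> = (1 - t) ^ n" using t4 by (simp add: exp_of_nat_mult)
    finally show ?thesis .
  qed
  define q where "q = exp (-1) * (1 - t) ^ n"
  have q: "exp (-1) * m powr (- \<beta> / 2) \<le> q" using q_ge by (simp add: q_def)
  have q1: "q \<le> 1"
  proof -
    have "exp (-1) * (1 - t) ^ n \<le> 1 * 1" using t0 t4 by (intro mult_mono power_le_one) auto
    then show ?thesis by (simp add: q_def)
  qed
  have "(1 - q) ^ (N - n) \<le> exp (- q) ^ (N - n)"
    using q1 exp_ge_add_one_self[of "- q"] by (intro power_mono) auto
  also have "\<dots> = exp (- (real n * (q * (m - 1))))"
    using N n0 by (simp add: exp_of_nat_mult[symmetric] of_nat_diff m_def field_simps)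
  finally have pow: "(1 - q) ^ (N - n) \<le> exp (- (real n * (q * (m - 1))))" .
  have two: "2 \<le> exp (real n)" using exp_ge_add_one_self[of "real n"] n by linarith
  have "2 * real ((N + n) choose n) * (1 - q) ^ (N - n)
      \<le> (exp (real n) * exp (real n * (1 + ln (m + 1)))) * exp (- (real n * (q * (m - 1))))"
    using two binomial_le_exp_power[of n N] n q1 pow unfolding m_def
    by (intro mult_mono mult_nonneg_nonneg) auto
  also have "\<dots> = exp (real n * (2 + ln (m + 1) - q * (m - 1)))"
    by (simp add: exp_add[symmetric] algebra_simps)
  also have "\<dots> < exp (real n * (- (m powr (1 - \<beta>))))"
  proof -
    have "exp (-1) * m powr (- \<beta> / 2) * (m - 1) \<le> q * (m - 1)" using q m1 by (intro mult_right_mono) auto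
    then have "2 + ln (m + 1) - q * (m - 1) < - (m powr (1 - \<beta>))" using dom by linarith
    then show ?thesis using n0 by (simp only: exp_less_cancel_iff mult_strict_left_mono)
  qed
  also have "real n * (- (m powr (1 - \<beta>))) = - (real N powr (1 - \<beta>) * real n powr \<beta>)"
  proof -
    have "real n = real n powr (1 - \<beta>) * real n powr \<beta>" using n0 by (simp add: powr_add[symmetric])
    then have "real n * m powr (1 - \<beta>) = real n powr (1 - \<beta>) * real n powr \<beta> * m powr (1 - \<beta>)" by simp
    also have "\<dots> = (real n * m) powr (1 - \<beta>) * real n powr \<beta>"
      using n0 m1 by (simp add: powr_mult mult_ac)
    also have "real n * m = real N" using n0 by (simp add: m_def)
    finally show ?thesis by simp
  qed
  finally show "2 * real ((N + n) choose n) * (1 - exp (-1) * (1 - t) ^ n) ^ (N - n)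
      < exp (- (real N powr (1 - \<beta>) * real n powr \<beta>))" by (simp add: q_def)
qed

theorem theorem1p3:
  shows "\<exists>c\<^sub>1::real. c\<^sub>1 > 0 \<and>
    (\<forall>\<beta>::real. 0 < \<beta> \<and> \<beta> < 1 \<longrightarrow>
      (\<exists>\<alpha>::real. \<alpha> > 1 \<and>
        (\<forall>(n::nat) (K :: (nat \<Rightarrow> real) set) (N::nat).
          n \<ge> 1 \<and> convex_body n K \<and> centered n K \<and>
          \<alpha> * real n \<le> real N \<and> real N \<le> exp (real n) \<longrightarrow>
          \<P>(x in uniform_points N n K.
              (\<lambda>v. (c\<^sub>1 * \<beta> * ln (real N / real n) / real n) *\<^sub>R v) ` K
                \<subseteq> convex hull (x ` {..<N}))
            > 1 - exp (- (real N powr (1 - \<beta>) * real n powr \<beta>)))))"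
proof (rule exI[of _ "1/4"], intro conjI allI impI)
  fix \<beta> :: real assume \<beta>: "0 < \<beta> \<and> \<beta> < 1"
  obtain \<alpha>\<^sub>0 where \<alpha>\<^sub>0: "\<And>m. \<alpha>\<^sub>0 \<le> m \<Longrightarrow>
      2 + ln (m + 1) + m powr (1 - \<beta>) < exp (-1) * m powr (- \<beta> / 2) * (m - 1)"
    using eventually_facet_count_dominated[of \<beta>] \<beta> by (auto simp: eventually_at_top_linorder)
  show "\<exists>\<alpha>::real. \<alpha> > 1 \<and>
        (\<forall>(n::nat) (K :: (nat \<Rightarrow> real) set) (N::nat).
          n \<ge> 1 \<and> convex_body n K \<and> centered n K \<and>
          \<alpha> * real n \<le> real N \<and> real N \<le> exp (real n) \<longrightarrow>
          \<P>(x in uniform_points N n K.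
              (\<lambda>v. (1/4 * \<beta> * ln (real N / real n) / real n) *\<^sub>R v) ` K
                \<subseteq> convex hull (x ` {..<N}))
            > 1 - exp (- (real N powr (1 - \<beta>) * real n powr \<beta>)))"
  \<comment> \<open>The 2 secures both \<alpha> > 1 and \<open>n < N\<close>;
    \<open>\<alpha>\<^sub>0\<close> is the threshold for the comparison of exponents.\<close>
  proof (intro exI[of _ "max 2 \<alpha>\<^sub>0"] conjI allI impI)
    fix n N :: nat and K :: "(nat \<Rightarrow> real) set"
    assume "n \<ge> 1 \<and> convex_body n K \<and> centered n K \<and>
      max 2 \<alpha>\<^sub>0 * real n \<le> real N \<and> real N \<le> exp (real n)"
    then have n: "1 \<le> n" and K: "convex_body n K" "centered n K"
      and N: "max 2 \<alpha>\<^sub>0 * real n \<le> real N" "real N \<le> exp (real n)" by auto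
    interpret Rn_body n K by standard (rule K)
    let ?m = "real N / real n"
    define t where "t = 1/4 * \<beta> * ln ?m / real n"
    have m: "max 2 \<alpha>\<^sub>0 \<le> ?m" using N n by (simp add: le_divide_eq)
    have "2 \<le> ?m" using m by simp
    then have nN: "real n < real N" using n by (simp add: le_divide_eq)
    have dom: "2 + ln (?m + 1) + ?m powr (1 - \<beta>) < exp (-1) * ?m powr (- \<beta> / 2) * (?m - 1)"
      using m by (intro \<alpha>\<^sub>0) simp
    note bound = failure_bound_lt[of \<beta> n N, OF _ _ n nN N(2) dom, folded t_def]
    have "1 - exp (- (real N powr (1 - \<beta>) * real n powr \<beta>))
        < 1 - 2 * real ((N + n) choose n) * (1 - exp (-1) * (1 - t) ^ n) ^ (N - n)"
      using bound(3) \<beta> by simp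
    also have "\<dots> \<le> \<P>(x in uniform_points N n K. (\<lambda>v. t *\<^sub>R v) ` K \<subseteq> convex hull (x ` {..<N}))"
      using bound(1,2) \<beta> nN K(2) by (intro prob_scaled_body_in_hull_ge) auto
    finally show "1 - exp (- (real N powr (1 - \<beta>) * real n powr \<beta>))
        < \<P>(x in uniform_points N n K. (\<lambda>v. (1/4 * \<beta> * ln ?m / real n) *\<^sub>R v) ` K
            \<subseteq> convex hull (x ` {..<N}))"
      by (simp only: t_def)
  qed simp
qed simp

end
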